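(* There exists an absolute constant $c>0$ such that the following holds. Let $M$ be a prime power and $\varepsilon\in(0,1/4)$, $\alpha\ge1$ real numbers. For all integers $t$ and $N$ with $\varepsilon\cdot M^{t-1}\ge1$ and $N\ge 6\varepsilon M^{2t}$, and for $T=\lceil\varepsilon^2M^{2t-1}\log(\alpha M/\varepsilon)\rceil$, there exist an integer $K\ge c\,MT/(\varepsilon\log(\alpha M/\varepsilon))$, a $2$-universal family $\mathcal{H}$ of hash functions $[N]\to[M]$, and a block $K$-source $\mathbf{X}=(X_1,\dots,X_T)$ over $[N]^T$ such that, with $H$ uniform over $\mathcal{H}$ and independent of $\mathbf{X}$, $\mathbf{Y}=(H(X_1),\dots,H(X_T))$ is $\varepsilon$-far in statistical distance from every distribution $\mathbf{Z}$ on $[M]^T$ with $\mathrm{cp}(\mathbf{Z})\le\alpha/M^T$.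
   Context: $[n]=\{1,\dots,n\}$. A hash family is a multiset of functions $[N]\to[M]$; it is $2$-universal if for all distinct $x_1,x_2$, $\Pr_H[H(x_1)=H(x_2)]\le1/M$. $\mathrm{cp}(X)=\sum_x\Pr[X=x]^2$. A sequence $(X_1,\dots,X_T)$ over $[N]^T$ is a block $K$-source if for every $i$ and every $x_{<i}$ in the support of $(X_1,\dots,X_{i-1})$, $\mathrm{cp}(X_i\mid X_{<i}=x_{<i})\le 1/K$. Statistical distance: $\Delta(X,Y)=\max_S|\Pr[X\in S]-\Pr[Y\in S]|$; $\varepsilon$-far means $\Delta\ge\varepsilon$. Logarithms are base $2$. *)

theory Defs
  imports "HOL-Probability.Probability" "HOL-Number_Theory.Prime_Powers"
begin

text \<open>
  \<open>[n]\<close> is \<open>{1..n}\<close>, and \<open>[n]\<^sup>T\<close> consists of lists of length \<open>T\<close>; list positions count from \<open>0\<close>,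
  so the \<open>i\<close>-th component (\<open>i = 1, \<dots>, T\<close>) of a tuple \<open>xs\<close> is \<open>xs ! (i - 1)\<close>.
  Random variables are represented by their distributions.
\<close>

definition tuples :: "nat \<Rightarrow> nat \<Rightarrow> nat list set" where
  "tuples n T = {xs. length xs = T \<and> set xs \<subseteq> {1..n}}"

definition collision_prob :: "'a pmf \<Rightarrow> real" where
  "collision_prob p = (\<Sum>\<^sub>\<infinity>x. (pmf p x)\<^sup>2)"

definition stat_dist :: "'a pmf \<Rightarrow> 'a pmf \<Rightarrow> real" where
  "stat_dist p q = (SUP S. \<bar>measure_pmf.prob p S - measure_pmf.prob q S\<bar>)"

definition eps_far :: "real \<Rightarrow> 'a pmf \<Rightarrow> 'a pmf \<Rightarrow> bool" where
  "eps_far \<epsilon> p q \<longleftrightarrow> stat_dist p q \<ge> \<epsilon>"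

text \<open>
  A family must be nonempty for a uniformly random member to exist; members are drawn according
  to their multiplicity.
\<close>

definition hash_family :: "nat \<Rightarrow> nat \<Rightarrow> (nat \<Rightarrow> nat) multiset \<Rightarrow> bool" where
  "hash_family N M \<H> \<longleftrightarrow> \<H> \<noteq> {#} \<and> set_mset \<H> \<subseteq> ({1..N} \<rightarrow>\<^sub>E {1..M})"

definition two_universal :: "nat \<Rightarrow> nat \<Rightarrow> (nat \<Rightarrow> nat) multiset \<Rightarrow> bool" where
  "two_universal N M \<H> \<longleftrightarrow> hash_family N M \<H> \<and>
     (\<forall>x\<^sub>1 \<in> {1..N}. \<forall>x\<^sub>2 \<in> {1..N}. x\<^sub>1 \<noteq> x\<^sub>2 \<longrightarrow>
        measure_pmf.prob (pmf_of_multiset \<H>) {h. h x\<^sub>1 = h x\<^sub>2} \<le> 1 / real M)"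

text \<open>
  Here \<open>i\<close> is the number of conditioned blocks, and \<open>u\<close> is a value of those blocks in their support.
\<close>

definition block_source :: "nat \<Rightarrow> nat \<Rightarrow> nat \<Rightarrow> nat list pmf \<Rightarrow> bool" where
  "block_source K N T X \<longleftrightarrow> set_pmf X \<subseteq> tuples N T \<and>
     (\<forall>i < T. \<forall>u \<in> set_pmf (map_pmf (take i) X).
        collision_prob (map_pmf (\<lambda>xs. xs ! i) (cond_pmf X {xs. take i xs = u})) \<le> 1 / real K)"

text \<open>The distribution of \<open>(H(X\<^sub>1), \<dots>, H(X\<^sub>T))\<close> for \<open>H\<close> uniform over the family and independent of \<open>X\<close>.\<close>

definition hashed :: "(nat \<Rightarrow> nat) multiset \<Rightarrow> nat list pmf \<Rightarrow> nat list pmf" where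
  "hashed \<H> X = map_pmf (\<lambda>(h, xs). map h xs) (pair_pmf (pmf_of_multiset \<H>) X)"

end

theory Submission
  imports Defs "HOL-Combinatorics.Permutations"
begin

text \<open>
  The source is uniform on \<open>[K]\<^sup>T\<close>. A hash function applies a template \<open>[K] \<rightarrow> [M]\<close> after a random
  permutation of \<open>[K]\<close> (and is completely random on the other points). A balanced template
  has collision probability a bit below \<open>1 / M\<close>, by about \<open>1 / K\<close>; this slack pays for using, with
  probability between \<open>3 \<epsilon>\<close> and \<open>4 \<epsilon>\<close>, a template on which the value \<open>1\<close> has an excess frequency
  of order \<open>1 / sqrt (\<epsilon> K)\<close>. For \<open>K\<close> a small multiple of \<open>\<epsilon> M^(2t)\<close>, this excess is visible in \<open>T\<close>
  samples: the number of ones in a biased sample exceeds a threshold that a uniform tuple passes only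
  with probability at most \<open>\<epsilon>\<^sup>2 / \<alpha>\<close>. By Cauchy-Schwarz, a distribution of collision probability
  at most \<open>\<alpha> / M^T\<close> then passes it with probability at most \<open>\<epsilon>\<close>. If \<open>\<epsilon> M^t\<close> is bounded, the
  excess is not small, and the biased template is replaced by a constant one. Below, \<open>Q\<close> is \<open>M^(t - 1)\<close>.
\<close>

section \<open>Counting occurrences in tuples\<close>

lemma tuples_0 [simp]: "tuples n 0 = {[]}"
  by (auto simp: tuples_def)

lemma tuples_Suc: "tuples n (Suc T) = (\<lambda>(x, xs). x # xs) ` ({1..n} \<times> tuples n T)"
  unfolding tuples_def
  by (auto simp: image_iff length_Suc_conv)

lemma finite_tuples [simp]: "finite (tuples n T)"
  by (induction T) (simp_all add: tuples_Suc)

lemma card_tuples: "card (tuples n T) = n ^ T"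
proof (induction T)
  case (Suc T)
  have "inj_on (\<lambda>(x, xs). x # xs) ({1..n} \<times> tuples n T)"
    by (auto simp: inj_on_def)
  then show ?case
    by (simp add: tuples_Suc card_image card_cartesian_product Suc)
qed simp

lemma tuples_nonempty: "n > 0 \<Longrightarrow> tuples n T \<noteq> {}"
  by (metis card_tuples card.empty power_not_zero less_numeral_extra(3))

lemma map_in_tuples: "xs \<in> tuples n T \<Longrightarrow> (\<And>x. x \<in> {1..n} \<Longrightarrow> f x \<in> {1..m}) \<Longrightarrow> map f xs \<in> tuples m T"
  by (auto simp: tuples_def)

section \<open>Chernoff bounds for the number of entries of a random tuple in a given set\<close>

text \<open>The weight is a product over positions, so the sum factors. Up to normalisation this is
  the generating function of a binomial count.\<close>

lemma sum_power_count_tuples: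
  fixes l :: real
  assumes "A \<subseteq> {1..n}"
  shows "(\<Sum>xs\<in>tuples n T. l ^ length (filter (\<lambda>x. x \<in> A) xs))
    = (real n - card A + card A * l) ^ T"
proof (induction T)
  case (Suc T)
  have inj: "inj_on (\<lambda>(x, xs). x # xs) ({1..n} \<times> tuples n T)"
    by (auto simp: inj_on_def)
  have "(\<Sum>x\<in>{1..n}. if x \<in> A then l else 1) = (\<Sum>x\<in>A. l) + (\<Sum>x\<in>{1..n} - A. 1)"
    using assms by (subst sum.subset_diff[of A]) (auto intro!: arg_cong2[of _ _ _ _ "(+)"])
  also have "\<dots> = real n - card A + card A * l"
    using assms card_mono[OF _ assms] finite_subset[OF assms] by (simp add: card_Diff_subset of_nat_diff)
  finally have *: "(\<Sum>x\<in>{1..n}. if x \<in> A then l else 1) = real n - card A + card A * l" .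
  have "(\<Sum>xs\<in>tuples n (Suc T). l ^ length (filter (\<lambda>x. x \<in> A) xs))
    = (\<Sum>(x, xs)\<in>{1..n} \<times> tuples n T. (if x \<in> A then l else 1) * l ^ length (filter (\<lambda>x. x \<in> A) xs))"
    unfolding tuples_Suc by (subst sum.reindex[OF inj]) (auto intro!: sum.cong)
  also have "\<dots> = (real n - card A + card A * l) ^ Suc T"
    by (simp add: sum.cartesian_product[symmetric] sum_distrib_left[symmetric]
        sum_distrib_right[symmetric] Suc * del: One_nat_def)
  finally show ?case .
qed simp

text \<open>Markov's inequality for \<open>l ^ count\<close> with base
  \<open>l = \<theta> / p\<close>. The direction of the tail enters only through \<open>le\<close>,
  so one bound serves both tails. The exponent has Hellinger form, weaker than relative entropy but
  symmetric in \<open>\<theta>\<close> and \<open>p\<close>.\<close>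

lemma count_tail_aux:
  fixes p \<theta> :: real
  assumes A: "A \<subseteq> {1..n}" and n: "n > 0" and p: "p = card A / n" "p > 0" and \<theta>: "\<theta> > 0"
    and B: "B \<subseteq> tuples n T"
    and le: "\<And>xs. xs \<in> B \<Longrightarrow>
      (\<theta> / p) powr (\<theta> * T) \<le> (\<theta> / p) ^ length (filter (\<lambda>x. x \<in> A) xs)"
  shows "card B \<le> real n ^ T * exp (- real T * (sqrt \<theta> - sqrt p)\<^sup>2)"
proof -
  define l where "l = \<theta> / p"
  have l: "l > 0" using p(2) \<theta> unfolding l_def by simp
  have "card B * l powr (\<theta> * T) = (\<Sum>xs\<in>B. l powr (\<theta> * T))" by simp
  also have "\<dots> \<le> (\<Sum>xs\<in>B. l ^ length (filter (\<lambda>x. x \<in> A) xs))"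
    using le by (intro sum_mono) (simp add: l_def)
  also have "\<dots> \<le> (\<Sum>xs\<in>tuples n T. l ^ length (filter (\<lambda>x. x \<in> A) xs))"
    using l B by (intro sum_mono2) auto
  also have "\<dots> = (real n - card A + card A * l) ^ T"
    by (rule sum_power_count_tuples[OF A])
  also have "real n - card A + card A * l = real n * (1 + (\<theta> - p))"
    using n p by (simp add: l_def field_simps)
  also have "(real n * (1 + (\<theta> - p))) ^ T \<le> (real n * exp (\<theta> - p)) ^ T"
  proof (intro power_mono mult_left_mono)
    have "card A \<le> n" using card_mono[OF _ A] by simp
    then have "p \<le> 1" using n by (simp add: p)
    then show "0 \<le> real n * (1 + (\<theta> - p))" using \<theta> by simp
  qed auto
  also have "\<dots> = real n ^ T * exp (T * (\<theta> - p))"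
    by (simp add: power_mult_distrib exp_of_nat_mult)
  finally have 1: "card B * l powr (\<theta> * T) \<le> real n ^ T * exp (T * (\<theta> - p))" .
  \<comment> \<open>\<open>ln x \<le> x - 1\<close> at \<open>x = sqrt (p / \<theta>)\<close> bounds
    the Poisson rate function \<open>\<theta> * ln l - (\<theta> - p)\<close> from below by the
    squared difference of the roots.\<close>
  have "ln (sqrt p / sqrt \<theta>) \<le> sqrt p / sqrt \<theta> - 1"
    using p(2) \<theta> by (intro ln_le_minus_one) simp
  then have "- ln l / 2 \<le> sqrt p / sqrt \<theta> - 1"
    using p(2) \<theta> by (simp add: l_def ln_div ln_sqrt field_simps)
  then have "\<theta> * (- ln l / 2) \<le> \<theta> * (sqrt p / sqrt \<theta> - 1)"
    using \<theta> by (intro mult_left_mono) auto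
  also have "\<theta> * (sqrt p / sqrt \<theta> - 1) = sqrt \<theta> * sqrt p - \<theta>"
    using \<theta> by (simp add: field_simps)
  finally have "(sqrt \<theta> - sqrt p)\<^sup>2 \<le> \<theta> * ln l - (\<theta> - p)"
    using p \<theta> by (simp add: power2_diff)
  then have "real T * (sqrt \<theta> - sqrt p)\<^sup>2 \<le> real T * (\<theta> * ln l - (\<theta> - p))"
    by (intro mult_left_mono) auto
  then have "exp (T * (\<theta> - p)) \<le> exp (- real T * (sqrt \<theta> - sqrt p)\<^sup>2) * l powr (\<theta> * T)"
    using l by (simp add: powr_def exp_add[symmetric] algebra_simps)
  then have "card B * l powr (\<theta> * T) \<le> real n ^ T * exp (- real T * (sqrt \<theta> - sqrt p)\<^sup>2) * l powr (\<theta> * T)"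
    using 1 by (smt (verit) mult.assoc mult_left_mono of_nat_0_le_iff zero_le_power)
  then show ?thesis using l by simp
qed

lemma count_upper_tail:
  fixes p \<theta> :: real
  assumes "A \<subseteq> {1..n}" "n > 0" "p = card A / n" "p > 0" "\<theta> \<ge> p"
  shows "card {xs \<in> tuples n T. real (length (filter (\<lambda>x. x \<in> A) xs)) \<ge> \<theta> * T}
    \<le> real n ^ T * exp (- real T * (sqrt \<theta> - sqrt p)\<^sup>2)"
proof (rule count_tail_aux[OF assms(1-4)])
  fix xs assume xs: "xs \<in> {xs \<in> tuples n T. real (length (filter (\<lambda>x. x \<in> A) xs)) \<ge> \<theta> * T}"
  have "\<theta> / p \<ge> 1" using assms(4,5) by simp
  then show "(\<theta> / p) powr (\<theta> * T) \<le> (\<theta> / p) ^ length (filter (\<lambda>x. x \<in> A) xs)"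
    using xs by (subst powr_realpow[symmetric]) (auto intro!: powr_mono)
qed (use assms(4,5) in auto)

lemma count_lower_tail:
  fixes p \<theta> :: real
  assumes "A \<subseteq> {1..n}" "n > 0" "p = card A / n" "\<theta> > 0" "\<theta> \<le> p"
  shows "card {xs \<in> tuples n T. real (length (filter (\<lambda>x. x \<in> A) xs)) \<le> \<theta> * T}
    \<le> real n ^ T * exp (- real T * (sqrt \<theta> - sqrt p)\<^sup>2)"
proof (rule count_tail_aux[OF assms(1-3)])
  fix xs assume xs: "xs \<in> {xs \<in> tuples n T. real (length (filter (\<lambda>x. x \<in> A) xs)) \<le> \<theta> * T}"
  have "\<theta> / p \<le> 1" "\<theta> / p > 0" using assms(4,5) by simp_all
  then show "(\<theta> / p) powr (\<theta> * T) \<le> (\<theta> / p) ^ length (filter (\<lambda>x. x \<in> A) xs)"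
    using xs by (subst powr_realpow[symmetric]) (auto intro!: powr_mono')
qed (use assms(4,5) in auto)

text \<open>Multiply by the conjugate \<open>sqrt a + sqrt b\<close>, whose square is at most
  \<open>2 * (a + b)\<close>. This makes the tail exponent a rational expression.\<close>

lemma sqrt_diff_ge:
  fixes a b :: real
  assumes "a > 0" "b > 0"
  shows "(a - b)\<^sup>2 / (2 * (a + b)) \<le> (sqrt a - sqrt b)\<^sup>2"
proof -
  have "(sqrt a + sqrt b)\<^sup>2 \<le> 2 * (a + b)"
    using assms sum_squares_bound[of "sqrt a" "sqrt b"] by (simp add: power2_sum)
  then have "(sqrt a - sqrt b)\<^sup>2 * (sqrt a + sqrt b)\<^sup>2 \<le> (sqrt a - sqrt b)\<^sup>2 * (2 * (a + b))"
    by (intro mult_left_mono) auto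
  moreover have "(sqrt a - sqrt b)\<^sup>2 * (sqrt a + sqrt b)\<^sup>2 = (a - b)\<^sup>2"
    using assms by (simp add: power_mult_distrib[symmetric] algebra_simps)
  ultimately show ?thesis
    using assms by (simp add: divide_le_eq)
qed

section \<open>Uniform block sources and statistical distance\<close>

lemma collision_prob_finite:
  assumes "finite A" "set_pmf p \<subseteq> A"
  shows "collision_prob p = (\<Sum>x\<in>A. (pmf p x)\<^sup>2)"
proof -
  have "collision_prob p = infsum (\<lambda>x. (pmf p x)\<^sup>2) A"
    unfolding collision_prob_def using assms
    by (intro infsum_cong_neutral) (auto simp: set_pmf_iff)
  then show ?thesis using assms by simp
qed

lemma collision_prob_pmf_of_set:
  assumes "finite A" "A \<noteq> {}"
  shows "collision_prob (pmf_of_set A) = 1 / card A"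
  using assms by (subst collision_prob_finite[of A]) (auto simp: power2_eq_square)

lemma pair_pmf_of_set:
  assumes "finite A" "A \<noteq> {}" "finite B" "B \<noteq> {}"
  shows "pair_pmf (pmf_of_set A) (pmf_of_set B) = pmf_of_set (A \<times> B)"
proof (rule pmf_eqI)
  fix z :: "'a \<times> 'b"
  show "pmf (pair_pmf (pmf_of_set A) (pmf_of_set B)) z = pmf (pmf_of_set (A \<times> B)) z"
    using assms by (cases z) (simp add: pmf_pair indicator_def card_cartesian_product)
qed

lemma cond_pmf_of_set:
  assumes "finite A" "A \<inter> B \<noteq> {}"
  shows "cond_pmf (pmf_of_set A) B = pmf_of_set (A \<inter> B)"
proof -
  have ne: "A \<noteq> {}" using assms by auto
  have c: "card (A \<inter> B) > 0" using assms by (simp add: card_gt_0_iff)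
  have "card A > 0" using ne assms by (simp add: card_gt_0_iff)
  then show ?thesis using assms ne c
    by (intro pmf_eqI) (subst pmf_cond, auto simp: measure_pmf_of_set indicator_def)
qed

text \<open>Fixing the first \<open>i\<close> entries leaves the next one uniform on
  \<open>[K]\<close>, with collision probability exactly \<open>1 / K\<close>.\<close>

lemma block_source_uniform:
  assumes "K > 0" "K \<le> N"
  shows "block_source K N T (pmf_of_set (tuples K T))"
  unfolding block_source_def
proof (intro conjI allI impI ballI)
  note ne = tuples_nonempty[OF assms(1)]
  show "set_pmf (pmf_of_set (tuples K T)) \<subseteq> tuples N T"
    using assms set_pmf_of_set[OF ne[of T] finite_tuples] by (force simp: tuples_def)
  fix i u assume i: "i < T" and "u \<in> set_pmf (map_pmf (take i) (pmf_of_set (tuples K T)))"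
  then have u: "u \<in> tuples K i"
    using set_pmf_of_set[OF ne[of T] finite_tuples] by (auto simp: tuples_def dest!: in_set_takeD)
  \<comment> \<open>The tuples with prefix \<open>u\<close> are parametrised by the next entry and a
    free suffix; the conditional law is the first marginal of this product.\<close>
  have B: "tuples K T \<inter> {xs. take i xs = u}
    = (\<lambda>(y, v). u @ y # v) ` ({1..K} \<times> tuples K (T - Suc i))" (is "?B = ?g ` ?C")
  proof (intro equalityI subsetI)
    fix xs assume "xs \<in> ?B"
    then have "xs = u @ xs ! i # drop (Suc i) xs" "xs ! i \<in> {1..K}" "drop (Suc i) xs \<in> tuples K (T - Suc i)"
      using i by (auto simp: tuples_def Cons_nth_drop_Suc dest: in_set_dropD nth_mem)
    then show "xs \<in> ?g ` ?C" by force
  next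
    fix xs assume "xs \<in> ?g ` ?C"
    then show "xs \<in> ?B" using i u by (auto simp: tuples_def subset_iff)
  qed
  have C: "finite ?C" "?C \<noteq> {}" using assms ne by auto
  have inj: "inj_on ?g ?C" by (auto simp: inj_on_def)
  have Bne: "tuples K T \<inter> {xs. take i xs = u} \<noteq> {}" unfolding B using C by blast
  have "cond_pmf (pmf_of_set (tuples K T)) {xs. take i xs = u} = pmf_of_set ?B"
    using Bne by (simp add: cond_pmf_of_set)
  also have "\<dots> = map_pmf ?g (pmf_of_set ?C)"
    unfolding B by (rule map_pmf_of_set_inj[OF inj C(2,1), symmetric])
  also have "pmf_of_set ?C = pair_pmf (pmf_of_set {1..K}) (pmf_of_set (tuples K (T - Suc i)))"
    using assms ne by (subst pair_pmf_of_set) auto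
  finally have "map_pmf (\<lambda>xs. xs ! i) (cond_pmf (pmf_of_set (tuples K T)) {xs. take i xs = u})
    = map_pmf fst (pair_pmf (pmf_of_set {1..K}) (pmf_of_set (tuples K (T - Suc i))))"
    using u by (simp add: map_pmf_comp tuples_def split_def nth_append fst_def[symmetric])
  then have "map_pmf (\<lambda>xs. xs ! i) (cond_pmf (pmf_of_set (tuples K T)) {xs. take i xs = u}) = pmf_of_set {1..K}"
    by (simp add: map_fst_pair_pmf)
  then show "collision_prob (map_pmf (\<lambda>xs. xs ! i)
      (cond_pmf (pmf_of_set (tuples K T)) {xs. take i xs = u})) \<le> 1 / real K"
    using assms by (simp add: collision_prob_pmf_of_set)
qed

text \<open>Cauchy-Schwarz for the masses on \<open>S\<close> against the constant 1. The finite
  \<open>A\<close> turns the collision probability into a finite sum.\<close>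

lemma prob_le_sqrt_collision_prob:
  assumes "finite S"
    and "set_pmf Z \<subseteq> A" "finite A"
  shows "measure_pmf.prob Z S \<le> sqrt (card S * collision_prob Z)"
proof -
  have "(\<Sum>x\<in>S. pmf Z x)\<^sup>2 \<le> card S * (\<Sum>x\<in>S. (pmf Z x)\<^sup>2)"
    using Cauchy_Schwarz_ineq_sum[of "\<lambda>_. 1" "pmf Z" S] by simp
  also have "(\<Sum>x\<in>S. (pmf Z x)\<^sup>2) \<le> (\<Sum>x\<in>S \<union> A. (pmf Z x)\<^sup>2)"
    using assms by (intro sum_mono2) auto
  also have "\<dots> = collision_prob Z"
    using assms by (intro collision_prob_finite[symmetric]) auto
  finally have "(measure_pmf.prob Z S)\<^sup>2 \<le> card S * collision_prob Z"
    using assms by (simp add: measure_measure_pmf_finite mult_left_mono)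
  then show ?thesis by (rule real_le_rsqrt)
qed

text \<open>One distinguishing event suffices, once the supremum is known to range over a bounded
  set of reals.\<close>

lemma eps_farI:
  assumes "measure_pmf.prob p S - measure_pmf.prob q S \<ge> \<epsilon>"
  shows "eps_far \<epsilon> p q"
proof -
  have "\<bar>measure_pmf.prob p S - measure_pmf.prob q S\<bar> \<le> 1" for S
    using measure_pmf.prob_le_1[of p S] measure_pmf.prob_le_1[of q S]
      measure_nonneg[of "measure_pmf p" S] measure_nonneg[of "measure_pmf q" S] by linarith
  then have "bdd_above (range (\<lambda>S. \<bar>measure_pmf.prob p S - measure_pmf.prob q S\<bar>))"
    by (intro bdd_aboveI[of _ 1]) auto
  then have "\<bar>measure_pmf.prob p S - measure_pmf.prob q S\<bar> \<le> stat_dist p q"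
    unfolding stat_dist_def by (intro cSUP_upper) auto
  then show ?thesis using assms by (simp add: eps_far_def)
qed

section \<open>Hash families from permuted templates\<close>

text \<open>A uniform permutation of a finite \<open>A\<close> sends two distinct points to a
  uniform ordered pair off the diagonal, so the share of such pairs that collide is the collision
  probability of the permuted \<open>f\<close>.\<close>

definition colliding_pairs :: "'a set \<Rightarrow> ('a \<Rightarrow> 'b) \<Rightarrow> ('a \<times> 'a) set" where
  "colliding_pairs A f = {(x, y). x \<in> A \<and> y \<in> A \<and> x \<noteq> y \<and> f x = f y}"

text \<open>\<open>F\<close> ignores coordinate \<open>a\<close>, so resetting that coordinate maps
  pairs of a matching function and a value bijectively onto all functions.\<close>

lemma card_PiE_matching:
  assumes "finite A" "finite C" "a \<in> A"
    and F: "\<And>r c. F (r(a := c)) = F r" "\<And>r. r \<in> A \<rightarrow>\<^sub>E C \<Longrightarrow> F r \<in> C"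
  shows "card {r \<in> A \<rightarrow>\<^sub>E C. r a = F r} * card C = card (A \<rightarrow>\<^sub>E C)"
proof -
  have "bij_betw (\<lambda>(r, c). r(a := c)) ({r \<in> A \<rightarrow>\<^sub>E C. r a = F r} \<times> C) (A \<rightarrow>\<^sub>E C)"
    using assms
    by (intro bij_betw_byWitness[where f' = "\<lambda>r. (r(a := F r), r a)"])
      (auto simp: PiE_iff extensional_def fun_eq_iff)
  then show ?thesis
    by (simp add: bij_betw_same_card[symmetric] card_cartesian_product[symmetric])
qed

text \<open>
  The number of permutations making a given pair of points collide does not depend on the pair,
  so it is computed by counting pairs of points and permutations in two ways.
\<close>

lemma card_permutes_collision:
  assumes A: "finite A" "x \<in> A" "y \<in> A" "x \<noteq> y"
  shows "card {\<pi>. \<pi> permutes A \<and> f (\<pi> x) = f (\<pi> y)} * (card A * (card A - 1))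
    = fact (card A) * card (colliding_pairs A f)"
proof -
  let ?P = "{\<pi>. \<pi> permutes A}"
  define D where "D = {(u, v). u \<in> A \<and> v \<in> A \<and> u \<noteq> v}"
  define n where "n u v = card {\<pi> \<in> ?P. f (\<pi> u) = f (\<pi> v)}" for u v
  have finP: "finite ?P" using A by (simp add: finite_permutations)
  have "D = A \<times> A - (\<lambda>u. (u, u)) ` A" by (auto simp: D_def)
  then have cardD: "card D = card A * (card A - 1)"
    using A by (subst (asm) D_def, simp add: D_def)
      (subst card_Diff_subset, auto simp: card_cartesian_product card_image inj_on_def diff_mult_distrib2)
  have finD: "finite D" by (rule finite_subset[of _ "A \<times> A"]) (use A in \<open>auto simp: D_def\<close>)
  \<comment> \<open>Composition with a permutation \<open>s\<close> taking \<open>(x, y)\<close> to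
    \<open>(u, v)\<close> turns the permutations colliding at \<open>(u, v)\<close> into those
    colliding at \<open>(x, y)\<close>.\<close>
  have same: "n u v = n x y" if "(u, v) \<in> D" for u v
  proof -
    have uv: "u \<in> A" "v \<in> A" "u \<noteq> v" using that by (auto simp: D_def)
    \<comment> \<open>\<open>z\<close> is the place of \<open>y\<close> after the first
      transposition; it differs from \<open>u\<close>, so the second one can move it to
      \<open>v\<close> and leave \<open>u\<close> fixed.\<close>
    define z where "z = Transposition.transpose x u y"
    define s where "s = Transposition.transpose z v \<circ> Transposition.transpose x u"
    have z: "z \<in> A" "z \<noteq> u" using A uv by (auto simp: z_def Transposition.transpose_def)
    have s: "s permutes A"
      unfolding s_def using A uv z by (intro permutes_compose permutes_swap_id) auto
    have sx: "s x = u" using z uv by (simp add: s_def Transposition.transpose_def)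
    have sy: "s y = v" by (simp add: s_def z_def[symmetric])
    have inv: "\<pi> \<circ> inv s \<circ> s = \<pi>" "\<pi> \<circ> s \<circ> inv s = \<pi>" for \<pi> :: "'a \<Rightarrow> 'a"
      using permutes_inv_o[OF s] by (simp_all add: o_assoc[symmetric])
    have iu: "inv s u = x" "inv s v = y"
      using permutes_inverses(2)[OF s] sx sy by metis+
    have "bij_betw (\<lambda>\<pi>. \<pi> \<circ> s) {\<pi> \<in> ?P. f (\<pi> u) = f (\<pi> v)} {\<pi> \<in> ?P. f (\<pi> x) = f (\<pi> y)}"
      using s permutes_inv[OF s]
      by (intro bij_betw_byWitness[where f' = "\<lambda>\<pi>. \<pi> \<circ> inv s"])
        (auto simp: inv sx sy iu intro: permutes_compose)
    then show ?thesis unfolding n_def by (rule bij_betw_same_card)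
  qed
  have pairs: "card {p \<in> D. f (\<pi> (fst p)) = f (\<pi> (snd p))} = card (colliding_pairs A f)" if p: "\<pi> permutes A" for \<pi>
  proof (rule bij_betw_same_card)
    show "bij_betw (map_prod \<pi> \<pi>) {p \<in> D. f (\<pi> (fst p)) = f (\<pi> (snd p))} (colliding_pairs A f)"
      using permutes_inverses[OF p] permutes_in_image[OF p] permutes_in_image[OF permutes_inv[OF p]]
        permutes_inj[OF p] permutes_inj[OF permutes_inv[OF p]]
      by (intro bij_betw_byWitness[where f' = "map_prod (inv \<pi>) (inv \<pi>)"])
        (auto simp: D_def colliding_pairs_def inj_eq)
  qed
  have "n x y * card D = (\<Sum>p\<in>D. n (fst p) (snd p))"
    using same by (simp add: split_def)
  also have "\<dots> = (\<Sum>p\<in>D. \<Sum>\<pi>\<in>?P. of_bool (f (\<pi> (fst p)) = f (\<pi> (snd p))))"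
    using finP by (simp add: n_def Int_def)
  also have "\<dots> = (\<Sum>\<pi>\<in>?P. \<Sum>p\<in>D. of_bool (f (\<pi> (fst p)) = f (\<pi> (snd p))))"
    by (rule sum.swap)
  also have "\<dots> = (\<Sum>\<pi>\<in>?P. card (colliding_pairs A f))"
    using finD pairs by (intro sum.cong) (auto simp: Int_def)
  also have "\<dots> = fact (card A) * card (colliding_pairs A f)"
    using card_permutations[OF refl A(1)] by simp
  finally show ?thesis by (simp add: n_def cardD)
qed

section \<open>The hash family, its seeds and its 2-universality\<close>

text \<open>A uniform seed makes the three choices independently. A template may occur under several
  numbers, which realises rational mixtures of templates.\<close>

definition template_index :: "nat \<Rightarrow> nat \<Rightarrow> nat \<Rightarrow> nat \<Rightarrow> (nat \<times> (nat \<Rightarrow> nat) \<times> (nat \<Rightarrow> nat)) set" where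
  "template_index n K N M = {..<n} \<times> {\<pi>. \<pi> permutes {1..K}} \<times> ({K<..N} \<rightarrow>\<^sub>E {1..M})"

definition template_hash ::
    "(nat \<Rightarrow> nat \<Rightarrow> nat) \<Rightarrow> nat \<Rightarrow> nat \<Rightarrow> nat \<times> (nat \<Rightarrow> nat) \<times> (nat \<Rightarrow> nat) \<Rightarrow> nat \<Rightarrow> nat" where
  "template_hash f K N = (\<lambda>(i, \<pi>, r). \<lambda>x\<in>{1..N}. if x \<le> K then f i (\<pi> x) else r x)"

text \<open>Multiplicities are kept, so a uniform member is the hash function of a uniform
  seed.\<close>

definition template_family ::
    "(nat \<Rightarrow> nat \<Rightarrow> nat) \<Rightarrow> nat \<Rightarrow> nat \<Rightarrow> nat \<Rightarrow> nat \<Rightarrow> (nat \<Rightarrow> nat) multiset" where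
  "template_family f n K N M = image_mset (template_hash f K N) (mset_set (template_index n K N M))"

lemma finite_template_index [simp]: "finite (template_index n K N M)"
  unfolding template_index_def
  by (intro finite_cartesian_product finite_permutations finite_PiE) auto

lemma template_index_nonempty:
  assumes "n > 0" "M > 0"
  shows "template_index n K N M \<noteq> {}"
proof -
  have "{\<pi>. \<pi> permutes {1..K}} \<noteq> {}" using permutes_id by blast
  then show ?thesis using assms by (auto simp: template_index_def PiE_eq_empty_iff)
qed

lemma card_template_index:
  "card (template_index n K N M) = n * (fact K * card ({K<..N} \<rightarrow>\<^sub>E {1..M}))"
  using card_permutations[of "{1..K}" K] by (simp add: template_index_def card_cartesian_product)

lemma pmf_of_template_family:
  assumes "n > 0" "M > 0"
  shows "pmf_of_multiset (template_family f n K N M)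
    = map_pmf (template_hash f K N) (pmf_of_set (template_index n K N M))"
  using assms by (simp add: template_family_def map_pmf_of_set template_index_nonempty)

text \<open>By \<open>card_permutes_collision\<close>, two points of \<open>[K]\<close> collide with
  the average over the templates of their shares of colliding pairs. \<open>coll\<close> bounds this
  average by \<open>1 / M\<close>, with denominators cleared.\<close>

lemma template_collision_inside:
  assumes xy: "x \<in> {1..K}" "y \<in> {1..K}" "x \<noteq> y" and K: "K \<le> N"
    and coll: "M * (\<Sum>i<n. card (colliding_pairs {1..K} (f i))) \<le> n * (K * (K - 1))"
  shows "card {p \<in> template_index n K N M. template_hash f K N p x = template_hash f K N p y} * M
    \<le> card (template_index n K N M)"
proof -
  let ?R = "{K<..N} \<rightarrow>\<^sub>E {1..M}"
  let ?P = "\<lambda>i. {\<pi>. \<pi> permutes {1..K} \<and> f i (\<pi> x) = f i (\<pi> y)}"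
  have "{p \<in> template_index n K N M. template_hash f K N p x = template_hash f K N p y}
    = (SIGMA i:{..<n}. ?P i \<times> ?R)"
    using xy K by (auto simp: template_index_def template_hash_def)
  moreover have "finite (?P i)" for i
    using finite_permutations[of "{1..K}"] by (rule rev_finite_subset) auto
  ultimately have "card {p \<in> template_index n K N M. template_hash f K N p x = template_hash f K N p y}
    = (\<Sum>i<n. card (?P i)) * card ?R"
    by (simp add: card_cartesian_product finite_PiE sum_distrib_right)
  moreover have "(\<Sum>i<n. card (?P i)) * M \<le> n * fact K"
  proof -
    have each: "card (?P i) * (K * (K - 1)) = fact K * card (colliding_pairs {1..K} (f i))" for i
      using card_permutes_collision[of "{1..K}" x y "f i"] xy by simp
    have "(\<Sum>i<n. card (?P i)) * M * (K * (K - 1)) = (\<Sum>i<n. card (?P i) * (K * (K - 1))) * M"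
      by (subst sum_distrib_right[symmetric]) (simp only: mult_ac)
    also have "\<dots> = (\<Sum>i<n. fact K * card (colliding_pairs {1..K} (f i))) * M"
      by (simp only: each)
    also have "\<dots> = fact K * (M * (\<Sum>i<n. card (colliding_pairs {1..K} (f i))))"
      by (simp add: sum_distrib_left mult_ac)
    also have "\<dots> \<le> fact K * (n * (K * (K - 1)))"
      using coll by (rule mult_left_mono) simp
    finally have "(\<Sum>i<n. card (?P i)) * M * (K * (K - 1)) \<le> n * fact K * (K * (K - 1))"
      by (simp only: mult_ac)
    moreover have "K * (K - 1) > 0" using xy by (cases "K = 1") auto
    ultimately show ?thesis by (rule mult_right_le_imp_le)
  qed
  then have "(\<Sum>i<n. card (?P i)) * M * card ?R \<le> n * fact K * card ?R"
    by (rule mult_right_mono) simp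
  ultimately show ?thesis
    by (simp add: card_template_index mult_ac)
qed

text \<open>\<open>r y\<close> is uniform and independent of the hash value of \<open>x\<close>,
  whether that comes from a template or from \<open>r\<close> at another point.\<close>

lemma template_collision_outside:
  assumes x: "x \<in> {1..N}" and y: "y \<in> {K<..N}" and neq: "x \<noteq> y" and "K \<le> N"
    and f: "\<And>i z. i < n \<Longrightarrow> z \<in> {1..K} \<Longrightarrow> f i z \<in> {1..M}"
  shows "card {p \<in> template_index n K N M. template_hash f K N p x = template_hash f K N p y} * M
    = card (template_index n K N M)"
proof -
  let ?R = "{K<..N} \<rightarrow>\<^sub>E {1..M}" and ?P = "{\<pi>. \<pi> permutes {1..K}}"
  define F where "F i \<pi> r = (if x \<le> K then f i (\<pi> x) else r x)" for i and \<pi> r :: "nat \<Rightarrow> nat"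
  have one: "card {r \<in> ?R. r y = F i \<pi> r} * M = card ?R" if "i < n" "\<pi> permutes {1..K}" for i \<pi>
  proof -
    have "F i \<pi> r \<in> {1..M}" if "r \<in> ?R" for r
    proof (cases "x \<le> K")
      case True
      then have "\<pi> x \<in> {1..K}" using x permutes_in_image[OF \<open>\<pi> permutes {1..K}\<close>, of x] by auto
      then show ?thesis using True f[OF \<open>i < n\<close>] by (simp add: F_def)
    next
      case False
      then show ?thesis using that x by (auto simp: F_def)
    qed
    then show ?thesis
      using card_PiE_matching[of "{K<..N}" "{1..M}" y "F i \<pi>"] y neq by (simp add: F_def)
  qed
  have "{p \<in> template_index n K N M. template_hash f K N p x = template_hash f K N p y}
    = (SIGMA i:{..<n}. SIGMA \<pi>:?P. {r \<in> ?R. r y = F i \<pi> r})"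
    using x y by (auto simp: template_index_def template_hash_def F_def)
  then have "card {p \<in> template_index n K N M. template_hash f K N p x = template_hash f K N p y} * M
    = (\<Sum>i<n. \<Sum>\<pi>\<in>?P. card {r \<in> ?R. r y = F i \<pi> r}) * M"
    by (simp add: finite_permutations finite_PiE)
  also have "\<dots> = (\<Sum>i<n. \<Sum>\<pi>\<in>?P. card ?R)"
    unfolding sum_distrib_right by (intro sum.cong refl) (use one in auto)
  also have "\<dots> = card (template_index n K N M)"
    using card_permutations[of "{1..K}" K] by (simp add: card_template_index)
  finally show ?thesis .
qed

lemma two_universal_template_family:
  assumes n: "n > 0" and M: "M > 0" and K: "K \<le> N"
    and f: "\<And>i z. i < n \<Longrightarrow> z \<in> {1..K} \<Longrightarrow> f i z \<in> {1..M}"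
    and coll: "M * (\<Sum>i<n. card (colliding_pairs {1..K} (f i))) \<le> n * (K * (K - 1))"
  shows "two_universal N M (template_family f n K N M)"
proof -
  let ?I = "template_index n K N M" and ?h = "template_hash f K N"
  note ne = template_index_nonempty[OF n M]
  have "?h p \<in> {1..N} \<rightarrow>\<^sub>E {1..M}" if "p \<in> ?I" for p
  proof -
    obtain i \<pi> r where p: "p = (i, \<pi>, r)" by (cases p)
    then have i: "i < n" "\<pi> permutes {1..K}" "r \<in> {K<..N} \<rightarrow>\<^sub>E {1..M}"
      using that by (auto simp: template_index_def)
    have "f i (\<pi> x) \<in> {1..M}" if "x \<in> {1..N}" "x \<le> K" for x
      using f[OF i(1)] permutes_in_image[OF i(2), of x] that by auto
    moreover have "r x \<in> {1..M}" if "x \<in> {1..N}" "\<not> x \<le> K" for x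
      using i(3) that by auto
    ultimately show ?thesis by (simp add: p template_hash_def del: atLeastAtMost_iff)
  qed
  then have "?h ` ?I \<subseteq> {1..N} \<rightarrow>\<^sub>E {1..M}" by (rule image_subsetI)
  then have "set_mset (template_family f n K N M) \<subseteq> {1..N} \<rightarrow>\<^sub>E {1..M}"
    by (simp only: template_family_def set_image_mset finite_set_mset_mset_set[OF finite_template_index])
  moreover have "template_family f n K N M \<noteq> {#}"
    using ne[of K N] by (simp add: template_family_def mset_set_empty_iff)
  ultimately have fam: "hash_family N M (template_family f n K N M)"
    by (simp add: hash_family_def)
  have le: "card {p \<in> ?I. ?h p x = ?h p y} * M \<le> card ?I"
    if "x \<in> {1..N}" "y \<in> {1..N}" "x \<noteq> y" for x y
  proof -
    consider "x \<le> K \<and> y \<le> K" | "y > K" | "x > K" by linarith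
    then show ?thesis
    proof cases
      case 1
      then show ?thesis using template_collision_inside[OF _ _ _ K coll] that by simp
    next
      case 2
      then show ?thesis using template_collision_outside[of x N y K n f M] that K f by simp
    next
      case 3
      then have "card {p \<in> ?I. ?h p y = ?h p x} * M = card ?I"
        using template_collision_outside[of y N x K n f M] that K f by simp
      then show ?thesis by (simp add: eq_commute)
    qed
  qed
  have "measure_pmf.prob (pmf_of_multiset (template_family f n K N M)) {h. h x = h y} \<le> 1 / real M"
    if "x \<in> {1..N}" "y \<in> {1..N}" "x \<noteq> y" for x y
  proof -
    have "measure_pmf.prob (pmf_of_multiset (template_family f n K N M)) {h. h x = h y}
      = card {p \<in> ?I. ?h p x = ?h p y} / card ?I"
      unfolding pmf_of_template_family[OF n M] measure_map_pmf
      using ne[of K N] by (subst measure_pmf_of_set) (simp_all add: vimage_def Int_def)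
    moreover have "card ?I > 0" using ne by (simp add: card_gt_0_iff)
    moreover have "real (card {p \<in> ?I. ?h p x = ?h p y} * M) \<le> real (card ?I)"
      using le[OF that] by (rule of_nat_mono)
    ultimately show ?thesis using M by (simp add: field_simps)
  qed
  with fam show ?thesis by (simp add: two_universal_def)
qed

text \<open>A permutation of \<open>[K]\<close> applied entrywise preserves the uniform distribution
  on \<open>tuples K T\<close>. So every seed with template number in \<open>J\<close> leads into
  \<open>S\<close> with probability at least \<open>q\<close>, and such seeds have total weight
  \<open>card J / n\<close>.\<close>

lemma prob_hashed_template_ge:
  assumes n: "n > 0" and M: "M > 0" and K: "K > 0" "K \<le> N" and J: "J \<subseteq> {..<n}"
    and S: "\<And>i. i \<in> J \<Longrightarrow> real (card {xs \<in> tuples K T. map (f i) xs \<in> S}) \<ge> q * real K ^ T"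
  shows "measure_pmf.prob (hashed (template_family f n K N M) (pmf_of_set (tuples K T))) S
    \<ge> card J / n * q"
proof -
  let ?I = "template_index n K N M" and ?h = "template_hash f K N"
  let ?R = "{K<..N} \<rightarrow>\<^sub>E {1..M}" and ?P = "{\<pi>. \<pi> permutes {1..K}}"
  let ?good = "{z \<in> ?I \<times> tuples K T. map (?h (fst z)) (snd z) \<in> S}"
  note ne = template_index_nonempty[OF n M] tuples_nonempty[OF K(1)]
  have finP: "finite ?P" by (simp add: finite_permutations)
  have finR: "finite ?R" by (simp add: finite_PiE)
  have fiber: "card {xs \<in> tuples K T. map (?h (i, \<pi>, r)) xs \<in> S} \<ge> q * real K ^ T"
    if "i \<in> J" "\<pi> permutes {1..K}" for i \<pi> r
  proof -
    have eq: "map (?h (i, \<pi>, r)) xs = map (f i) (map \<pi> xs)" if "xs \<in> tuples K T" for xs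
      using that K by (fastforce simp: template_hash_def tuples_def)
    then have "{xs \<in> tuples K T. map (?h (i, \<pi>, r)) xs \<in> S}
      = {xs \<in> tuples K T. map (f i) (map \<pi> xs) \<in> S}"
      by (intro Collect_cong conj_cong refl) (simp only: eq)
    moreover have "bij_betw (map \<pi>) {xs \<in> tuples K T. map (f i) (map \<pi> xs) \<in> S}
        {xs \<in> tuples K T. map (f i) xs \<in> S}"
      using permutes_inv_o[OF that(2)] permutes_in_image[OF that(2)]
        permutes_in_image[OF permutes_inv[OF that(2)]]
      by (intro bij_betw_byWitness[where f' = "map (inv \<pi>)"])
        (auto intro!: map_in_tuples simp: comp_assoc simp del: atLeastAtMost_iff)
    ultimately show ?thesis using S[OF that(1)] by (simp add: bij_betw_same_card)
  qed
  have "card J * (fact K * card ?R) * (q * real K ^ T)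
    = (\<Sum>p \<in> J \<times> ?P \<times> ?R. q * real K ^ T)"
    using card_permutations[of "{1..K}" K] by (simp add: card_cartesian_product)
  also have "\<dots> \<le> (\<Sum>p \<in> J \<times> ?P \<times> ?R. real (card {xs \<in> tuples K T. map (?h p) xs \<in> S}))"
    using fiber by (intro sum_mono) auto
  also have "\<dots> = card (SIGMA p : J \<times> ?P \<times> ?R. {xs \<in> tuples K T. map (?h p) xs \<in> S})"
    using finP finR finite_subset[OF J] by simp
  also have "\<dots> \<le> card ?good"
    using J by (intro of_nat_mono card_mono) (auto simp: template_index_def[symmetric], auto simp: template_index_def)
  finally have "card J * (fact K * card ?R) * (q * real K ^ T) \<le> card ?good" .
  then have "card J * (fact K * card ?R) * (q * real K ^ T) / (n * (fact K * card ?R) * real K ^ T)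
    \<le> card ?good / (n * (fact K * card ?R) * real K ^ T)"
    by (rule divide_right_mono) simp
  moreover have "card ?R > 0" using M finR by (simp add: card_gt_0_iff PiE_eq_empty_iff)
  ultimately have "card J / n * q \<le> card ?good / (n * (fact K * card ?R) * real K ^ T)"
    using K n by simp
  also have "\<dots> = card ?good / card (?I \<times> tuples K T)"
    by (simp add: card_cartesian_product card_template_index card_tuples)
  also have "\<dots> = measure_pmf.prob (pmf_of_set (?I \<times> tuples K T)) {z. map (?h (fst z)) (snd z) \<in> S}"
    using ne by (simp add: measure_pmf_of_set Int_def)
  also have "pmf_of_set (?I \<times> tuples K T) = pair_pmf (pmf_of_set ?I) (pmf_of_set (tuples K T))"
    using ne by (simp add: pair_pmf_of_set)
  also have "measure_pmf.prob (pair_pmf (pmf_of_set ?I) (pmf_of_set (tuples K T))) {z. map (?h (fst z)) (snd z) \<in> S}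
    = measure_pmf.prob (hashed (template_family f n K N M) (pmf_of_set (tuples K T))) S"
    using n M
    by (simp add: hashed_def pmf_of_template_family pair_map_pmf1 map_pmf_comp split_def vimage_def)
  finally show ?thesis .
qed

section \<open>Biased templates\<close>

text \<open>Pairs with equal values form disjoint squares of fibres; the diagonal accounts for
  \<open>card A\<close>.\<close>

lemma card_colliding_pairs:
  assumes A: "finite A" and B: "finite B" "f ` A \<subseteq> B"
  shows "card (colliding_pairs A f) + card A = (\<Sum>b\<in>B. (card {x \<in> A. f x = b})\<^sup>2)"
proof -
  let ?D = "(\<lambda>x. (x, x)) ` A" and ?F = "\<lambda>b. {x \<in> A. f x = b}"
  have un: "colliding_pairs A f \<union> ?D = (\<Union>b\<in>B. ?F b \<times> ?F b)"
  proof (intro equalityI subsetI)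
    fix p assume "p \<in> colliding_pairs A f \<union> ?D"
    then have "fst p \<in> A" "snd p \<in> A" "f (fst p) = f (snd p)"
      by (auto simp: colliding_pairs_def)
    moreover from this(1) have "f (fst p) \<in> B" using B(2) by blast
    ultimately show "p \<in> (\<Union>b\<in>B. ?F b \<times> ?F b)" by (cases p) simp
  next
    fix p assume "p \<in> (\<Union>b\<in>B. ?F b \<times> ?F b)"
    then show "p \<in> colliding_pairs A f \<union> ?D"
      by (cases p) (auto simp: colliding_pairs_def)
  qed
  have "card (\<Union>b\<in>B. ?F b \<times> ?F b) = (\<Sum>b\<in>B. card (?F b \<times> ?F b))"
    by (rule card_UN_disjoint) (use A in \<open>auto simp: B(1)\<close>)
  also have "\<dots> = (\<Sum>b\<in>B. (card (?F b))\<^sup>2)"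
    by (simp only: card_cartesian_product power2_eq_square)
  finally have sq: "card (\<Union>b\<in>B. ?F b \<times> ?F b) = (\<Sum>b\<in>B. (card (?F b))\<^sup>2)" .
  have "finite (colliding_pairs A f)"
    by (rule finite_subset[of _ "A \<times> A"]) (use A in \<open>auto simp: colliding_pairs_def\<close>)
  then have "card (colliding_pairs A f \<union> ?D) = card (colliding_pairs A f) + card ?D"
    using A by (intro card_Un_disjoint) (auto simp: colliding_pairs_def)
  also have "card ?D = card A" by (intro card_image) (auto simp: inj_on_def)
  finally show ?thesis by (simp only: un sq)
qed

text \<open>
  With \<open>e = 0\<close> this is balanced; as \<open>e\<close> grows, the value \<open>1\<close> gets heavier at the expense of
  all the others equally.
\<close>

definition biased_template :: "nat \<Rightarrow> nat \<Rightarrow> nat \<Rightarrow> nat" where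
  "biased_template M e x = (if x \<le> M * e then 1 else (x - 1) mod M + 1)"

lemma biased_template_range: "M > 0 \<Longrightarrow> biased_template M e x \<in> {1..M}"
  by (simp add: biased_template_def Suc_le_eq)

text \<open>Beyond \<open>M * e\<close> there are \<open>k - e\<close> full blocks of length
  \<open>M\<close>, and each block takes every value once.\<close>

lemma card_biased_template:
  assumes y: "y \<in> {1..M}" and ek: "e \<le> k"
  shows "card {x \<in> {1..M * k}. biased_template M e x = y} = (if y = 1 then M * e else 0) + (k - e)"
proof -
  have M: "M > 0" using y by auto
  have divmod: "(M * q + r) div M = q" "(M * q + r) mod M = r" if "r < M" for q r
    using that by simp_all
  \<comment> \<open>Block \<open>q\<close> takes the value \<open>y\<close> at
    \<open>M * q + y\<close>; values start at 1 and residues at 0, hence the shifts by 1.\<close>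
  have "bij_betw (\<lambda>q. M * q + y) {e..<k} {x \<in> {M * e<..M * k}. (x - 1) mod M + 1 = y}"
  proof (intro bij_betw_byWitness[where f' = "\<lambda>x. (x - 1) div M"] ballI)
    fix q assume "q \<in> {e..<k}"
    have "(M * q + (y - 1)) div M = q" using y by (intro divmod(1)) auto
    moreover have "M * q + y - 1 = M * q + (y - 1)" using y by auto
    ultimately show "(M * q + y - 1) div M = q" by (simp only:)
  next
    fix x assume "x \<in> {x \<in> {M * e<..M * k}. (x - 1) mod M + 1 = y}"
    then have "x \<ge> 1" "(x - 1) mod M + 1 = y" by auto
    then show "M * ((x - 1) div M) + y = x"
      using mult_div_mod_eq[of M "x - 1"] by linarith
  next
    show "(\<lambda>q. M * q + y) ` {e..<k} \<subseteq> {x \<in> {M * e<..M * k}. (x - 1) mod M + 1 = y}"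
    proof clarify
      fix q assume q: "q \<in> {e..<k}"
      have "(M * q + (y - 1)) mod M = y - 1" using y by (intro divmod(2)) auto
      moreover have "M * q + y - 1 = M * q + (y - 1)" using y by auto
      ultimately have "(M * q + y - 1) mod M = y - 1" by (simp only:)
      then have 1: "(M * q + y - 1) mod M + 1 = y" using y by auto
      have "M * e \<le> M * q" using q by simp
      moreover have "M * (q + 1) \<le> M * k" using q by (intro mult_le_mono2) auto
      ultimately have "M * q + y \<in> {M * e<..M * k}"
        using y unfolding greaterThanAtMost_iff atLeastAtMost_iff by (simp only: distrib_left mult_1_right) linarith
      with 1 show "M * q + y \<in> {M * e<..M * k} \<and> (M * q + y - 1) mod M + 1 = y" by blast
    qed
    show "(\<lambda>x. (x - 1) div M) ` {x \<in> {M * e<..M * k}. (x - 1) mod M + 1 = y} \<subseteq> {e..<k}"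
    proof clarify
      fix x assume "x \<in> {M * e<..M * k}"
      then have "M * e \<le> x - 1" "x - 1 < M * k" by auto
      then have "M * e div M \<le> (x - 1) div M" "(x - 1) div M < k"
        by (simp_all only: div_le_mono less_mult_imp_div_less mult.commute)
      then show "(x - 1) div M \<in> {e..<k}" using M by simp
    qed
  qed
  then have "card {x \<in> {M * e<..M * k}. (x - 1) mod M + 1 = y} = k - e"
    by (simp add: bij_betw_same_card[symmetric])
  moreover have "x \<le> M * k" if "x \<le> M * e" for x
    using order_trans[OF that mult_le_mono2[OF ek]] .
  then have "{x \<in> {1..M * k}. biased_template M e x = y}
    = (if y = 1 then {1..M * e} else {}) \<union> {x \<in> {M * e<..M * k}. (x - 1) mod M + 1 = y}"
    by (auto simp: biased_template_def)
  moreover have "card ((if y = 1 then {1..M * e} else {}) \<union> {x \<in> {M * e<..M * k}. (x - 1) mod M + 1 = y})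
    = card (if y = 1 then {1..M * e} else {}) + card {x \<in> {M * e<..M * k}. (x - 1) mod M + 1 = y}"
    by (intro card_Un_disjoint) auto
  ultimately show ?thesis by simp
qed

text \<open>One fibre has \<open>k + (M - 1) * e\<close> points and the others \<open>k - e\<close>,
  so the terms linear in \<open>e\<close> cancel: the excess over the balanced template is quadratic
  in the bias.\<close>

lemma card_colliding_pairs_biased_template:
  assumes M: "M > 0" and ek: "e \<le> k"
  shows "real (card (colliding_pairs {1..M * k} (biased_template M e)))
    = M * k\<^sup>2 + M * (real M - 1) * e\<^sup>2 - M * k"
proof -
  have "card (colliding_pairs {1..M * k} (biased_template M e)) + M * k
    = (\<Sum>y\<in>{1..M}. (card {x \<in> {1..M * k}. biased_template M e x = y})\<^sup>2)"
    using card_colliding_pairs[of "{1..M * k}" "{1..M}" "biased_template M e"]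
      biased_template_range[OF M] by (simp add: image_subset_iff)
  also have "\<dots> = (\<Sum>y\<in>{1..M}. ((if y = 1 then M * e else 0) + (k - e))\<^sup>2)"
    using ek by (intro sum.cong refl arg_cong[where f = "\<lambda>c. c\<^sup>2"] card_biased_template)
  also have "\<dots> = (M * e + (k - e))\<^sup>2 + (\<Sum>y\<in>{1..M} - {1}. (k - e)\<^sup>2)"
    using M by (subst sum.remove[of _ 1]) (auto intro!: sum.cong)
  also have "\<dots> = (M * e + (k - e))\<^sup>2 + (M - 1) * (k - e)\<^sup>2"
    using M by simp
  finally have "real (card (colliding_pairs {1..M * k} (biased_template M e))) + real M * k
    = (real M * e + real (k - e))\<^sup>2 + real (M - 1) * (real (k - e))\<^sup>2"
    by (simp only: of_nat_add[symmetric] of_nat_mult[symmetric] of_nat_power[symmetric])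
  moreover have "real (k - e) = real k - e" "real (M - 1) = real M - 1"
    using M ek by (simp_all add: of_nat_diff)
  ultimately show ?thesis by (simp add: power2_eq_square algebra_simps)
qed

section \<open>From templates to outputs far from every low-collision distribution\<close>

text \<open>The weight of the biased template must be rational, since members are drawn uniformly
  from a finite multiset.\<close>

lemma rational_between:
  fixes a b :: real
  assumes "0 \<le> a" "a < b"
  shows "\<exists>(m::nat) (n::nat). n > 0 \<and> a \<le> m / n \<and> m / n \<le> b"
proof -
  obtain q :: real where q: "q \<in> \<rat>" "a < q" "q < b"
    using Rats_dense_in_real[OF assms(2)] by auto
  then obtain m n where "n \<noteq> 0" "\<bar>q\<bar> = real m / real n" using Rats_abs_nat_div_natE[of q] by metis
  then show ?thesis using q assms by (intro exI[of _ m] exI[of _ n]) simp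
qed

text \<open>\<open>f1\<close> gets a weight between \<open>3 * \<epsilon>\<close> and
  \<open>4 * \<epsilon>\<close>. The upper bound and \<open>coll\<close> give 2-universality. By the
  lower bound the output hits \<open>S\<close> with probability at least
  \<open>3 * \<epsilon> * (2 / 3) = 2 * \<epsilon>\<close>, while \<open>Z\<close> does so with
  probability at most \<open>\<epsilon>\<close>.\<close>

lemma exists_far_of_templates:
  fixes \<epsilon> \<alpha> :: real
  assumes M: "M > 0" and K: "K > 0" "K \<le> N" and \<epsilon>: "0 < \<epsilon>" "\<epsilon> < 1 / 4" and \<alpha>: "\<alpha> > 0"
    and f: "\<And>x. x \<in> {1..K} \<Longrightarrow> f0 x \<in> {1..M}" "\<And>x. x \<in> {1..K} \<Longrightarrow> f1 x \<in> {1..M}"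
    and C: "C0 = real (card (colliding_pairs {1..K} f0))" "C1 = real (card (colliding_pairs {1..K} f1))"
    and coll: "C0 \<le> C1" "real M * (C0 + 4 * \<epsilon> * (C1 - C0)) \<le> real K * (real K - 1)"
    and S: "S \<subseteq> tuples M T" "\<alpha> * card S \<le> \<epsilon>\<^sup>2 * real M ^ T"
    and hit: "real (card {xs \<in> tuples K T. map f1 xs \<in> S}) \<ge> 2 / 3 * real K ^ T"
  shows "\<exists>\<H> X. two_universal N M \<H> \<and> block_source K N T X \<and>
    (\<forall>Z. set_pmf Z \<subseteq> tuples M T \<longrightarrow> collision_prob Z \<le> \<alpha> / real M ^ T \<longrightarrow> eps_far \<epsilon> (hashed \<H> X) Z)"
proof -
  obtain j n :: nat where n: "n > 0" and jn: "3 * \<epsilon> \<le> j / n" "j / n \<le> 4 * \<epsilon>"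
    using rational_between[of "3 * \<epsilon>" "4 * \<epsilon>"] \<epsilon> by auto
  have "j / n < 1" using jn \<epsilon> by simp
  then have "j \<le> n" using n by simp
  define f where "f i = (if i < j then f1 else f0)" for i
  let ?H = "template_family f n K N M" and ?X = "pmf_of_set (tuples K T)"
  have "two_universal N M ?H"
  proof (rule two_universal_template_family)
    have "{..<n} = {..<j} \<union> {j..<n}" using \<open>j \<le> n\<close> by auto
    then have "(\<Sum>i<n. real (card (colliding_pairs {1..K} (f i))))
      = (\<Sum>i<j. real (card (colliding_pairs {1..K} (f i)))) + (\<Sum>i\<in>{j..<n}. real (card (colliding_pairs {1..K} (f i))))"
      by (simp add: sum.union_disjoint ivl_disj_int)
    also have "\<dots> = j * C1 + (real n - j) * C0"
      using \<open>j \<le> n\<close> by (simp add: f_def C of_nat_diff)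
    also have "\<dots> = n * (C0 + j / n * (C1 - C0))"
      using n by (simp add: field_simps)
    also have "\<dots> \<le> n * (C0 + 4 * \<epsilon> * (C1 - C0))"
      using jn coll by (intro mult_left_mono add_left_mono mult_right_mono) auto
    finally have "real M * (\<Sum>i<n. real (card (colliding_pairs {1..K} (f i))))
      \<le> real M * (n * (C0 + 4 * \<epsilon> * (C1 - C0)))"
      by (rule mult_left_mono) simp
    also have "\<dots> \<le> n * (real K * (real K - 1))"
      using mult_left_mono[OF coll(2), of "real n"] by (simp add: mult_ac)
    also have "\<dots> = real (n * (K * (K - 1)))"
      using K by (simp add: of_nat_diff)
    finally have "real (M * (\<Sum>i<n. card (colliding_pairs {1..K} (f i)))) \<le> real (n * (K * (K - 1)))"
      by simp
    then show "M * (\<Sum>i<n. card (colliding_pairs {1..K} (f i))) \<le> n * (K * (K - 1))"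
      by (simp only: of_nat_le_iff)
  qed (use n M K f in \<open>auto simp: f_def simp del: atLeastAtMost_iff\<close>)
  moreover have "block_source K N T ?X"
    using K by (rule block_source_uniform)
  moreover have "eps_far \<epsilon> (hashed ?H ?X) Z"
    if Z: "set_pmf Z \<subseteq> tuples M T" "collision_prob Z \<le> \<alpha> / real M ^ T" for Z
  proof (rule eps_farI)
    have "card {..<j} / n * (2 / 3) \<le> measure_pmf.prob (hashed ?H ?X) S"
      by (rule prob_hashed_template_ge) (use n M K \<open>j \<le> n\<close> hit in \<open>auto simp: f_def\<close>)
    then have 1: "measure_pmf.prob (hashed ?H ?X) S \<ge> 2 * \<epsilon>" using jn by simp
    have "measure_pmf.prob Z S \<le> sqrt (card S * collision_prob Z)"
      using finite_subset[OF S(1)] Z by (intro prob_le_sqrt_collision_prob[of _ _ "tuples M T"]) auto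
    also have "card S * collision_prob Z \<le> card S * (\<alpha> / real M ^ T)"
      using Z by (intro mult_left_mono) auto
    also have "\<dots> \<le> \<epsilon>\<^sup>2" using S(2) M by (simp add: field_simps)
    also have "sqrt (\<epsilon>\<^sup>2) = \<epsilon>" using \<epsilon> by simp
    finally show "\<epsilon> \<le> measure_pmf.prob (hashed ?H ?X) S - measure_pmf.prob Z S"
      using 1 by (simp add: real_sqrt_le_mono)
  qed
  ultimately show ?thesis by blast
qed

text \<open>For \<open>K = M * k\<close> the balanced template leaves slack
  \<open>M * (M - 1) * k\<close> in the collision condition, and the bias costs
  \<open>4 * \<epsilon> * M\<^sup>2 * (M - 1) * e\<^sup>2\<close>; \<open>bias\<close> compares the
  two.\<close>

lemma exists_far_of_biased_template:
  fixes \<epsilon> \<alpha> :: real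
  assumes M: "M > 0" and k: "k > 0" "M * k \<le> N" "e \<le> k" and \<epsilon>: "0 < \<epsilon>" "\<epsilon> < 1 / 4" and \<alpha>: "\<alpha> > 0"
    and bias: "4 * \<epsilon> * M * (real e)\<^sup>2 \<le> k"
    and S: "S \<subseteq> tuples M T" "\<alpha> * card S \<le> \<epsilon>\<^sup>2 * real M ^ T"
    and hit: "real (card {xs \<in> tuples (M * k) T. map (biased_template M e) xs \<in> S}) \<ge> 2 / 3 * real (M * k) ^ T"
  shows "\<exists>\<H> X. two_universal N M \<H> \<and> block_source (M * k) N T X \<and>
    (\<forall>Z. set_pmf Z \<subseteq> tuples M T \<longrightarrow> collision_prob Z \<le> \<alpha> / real M ^ T \<longrightarrow> eps_far \<epsilon> (hashed \<H> X) Z)"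
proof (rule exists_far_of_templates[where ?f0.0 = "biased_template M 0" and ?f1.0 = "biased_template M e", OF _ _ _ _ _ _ _ _ refl refl])
  have "real M * (real M - 1) * (4 * \<epsilon> * M * (real e)\<^sup>2) \<le> real M * (real M - 1) * k"
    using bias M by (intro mult_left_mono) auto
  then show "real M * (real (card (colliding_pairs {1..M * k} (biased_template M 0)))
      + 4 * \<epsilon> * (real (card (colliding_pairs {1..M * k} (biased_template M e)))
        - real (card (colliding_pairs {1..M * k} (biased_template M 0)))))
    \<le> real (M * k) * (real (M * k) - 1)"
    unfolding card_colliding_pairs_biased_template[OF M k(3)] card_colliding_pairs_biased_template[OF M le0]
    by (simp add: power2_eq_square algebra_simps)
  have "0 \<le> real M * (real M - 1) * (real e)\<^sup>2" using M by simp
  then show "real (card (colliding_pairs {1..M * k} (biased_template M 0)))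
    \<le> real (card (colliding_pairs {1..M * k} (biased_template M e)))"
    unfolding card_colliding_pairs_biased_template[OF M k(3)] card_colliding_pairs_biased_template[OF M le0]
    by simp
qed (use M k \<epsilon> \<alpha> S hit biased_template_range in \<open>auto simp del: atLeastAtMost_iff\<close>)

section \<open>Choice of parameters\<close>

lemma exp_minus_log_le:
  fixes y :: real
  assumes "y \<ge> 1"
  shows "exp (- (2 * log 2 y)) \<le> 1 / y\<^sup>2"
proof -
  have "ln 2 \<le> (1 :: real)" using ln_le_minus_one[of "2 :: real"] by simp
  then have "ln y \<le> log 2 y"
    using assms mult_left_mono[of "ln 2" 1 "ln y"] by (simp add: log_def field_simps)
  then have "exp (- (2 * log 2 y)) \<le> exp (- (2 * ln y))" by simp
  also have "\<dots> = 1 / y\<^sup>2"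
    using assms by (simp add: exp_minus exp_double inverse_eq_divide)
  finally show ?thesis .
qed

lemma log_ratio_ge:
  fixes \<epsilon> \<alpha> :: real
  assumes "M \<ge> 2" "0 < \<epsilon>" "\<epsilon> < 1 / 4" "\<alpha> \<ge> 1"
  shows "\<alpha> * real M / \<epsilon> \<ge> 8" "log 2 (\<alpha> * real M / \<epsilon>) \<ge> 3"
proof -
  have "8 * \<epsilon> \<le> 1 * real M" using assms by simp
  also have "\<dots> \<le> \<alpha> * real M" using assms by (intro mult_right_mono) auto
  finally show *: "\<alpha> * real M / \<epsilon> \<ge> 8" using assms by (simp add: field_simps)
  have "log 2 (2 ^ 3) \<le> log 2 (\<alpha> * real M / \<epsilon>)" using * by (subst log_le_cancel_iff) auto
  then show "log 2 (\<alpha> * real M / \<epsilon>) \<ge> 3" by (simp only: log_pow_cancel)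
qed

text \<open>A tail probability of \<open>(\<alpha> * M / \<epsilon>) powr (-2)\<close> is thus
  within the density \<open>\<epsilon>\<^sup>2 / \<alpha>\<close> that the Cauchy-Schwarz step
  allows for \<open>S\<close>.\<close>

lemma alpha_div_square_le:
  fixes \<epsilon> \<alpha> :: real
  assumes "M \<ge> 1" "0 < \<epsilon>" "\<alpha> \<ge> 1"
  shows "\<alpha> / (\<alpha> * real M / \<epsilon>)\<^sup>2 \<le> \<epsilon>\<^sup>2"
proof -
  have "1 * 1 \<le> \<alpha> * (real M)\<^sup>2" using assms by (intro mult_mono) auto
  then have "\<epsilon>\<^sup>2 * 1 \<le> \<epsilon>\<^sup>2 * (\<alpha> * (real M)\<^sup>2)" using assms by (intro mult_left_mono) auto
  then show ?thesis using assms by (simp add: field_simps power2_eq_square)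
qed

text \<open>Here the required \<open>K\<close> is at most \<open>1 / (2 ^ 16 * \<epsilon>)\<close>,
  small enough for a template that is constantly 1 on \<open>[K]\<close>. It always hits the event
  consisting of the single all-ones tuple.\<close>

lemma exists_far_bounded:
  fixes \<epsilon> \<alpha> Q :: real
  assumes M: "M \<ge> 2" and \<epsilon>: "0 < \<epsilon>" "\<epsilon> < 1 / 4" and \<alpha>: "\<alpha> \<ge> 1"
    and Q: "\<epsilon> * Q \<ge> 1" "\<epsilon> * Q * M < 2 ^ 14"
    and N: "real N \<ge> 6 * \<epsilon> * Q\<^sup>2 * (real M)\<^sup>2"
    and T: "real T \<ge> \<epsilon>\<^sup>2 * Q\<^sup>2 * M * log 2 (\<alpha> * M / \<epsilon>)"
  shows "\<exists>K \<H> X. real K \<ge> \<epsilon> * Q\<^sup>2 * (real M)\<^sup>2 / 2 ^ 44 \<and> two_universal N M \<H> \<and> block_source K N T X \<and>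
    (\<forall>Z. set_pmf Z \<subseteq> tuples M T \<longrightarrow> collision_prob Z \<le> \<alpha> / real M ^ T \<longrightarrow> eps_far \<epsilon> (hashed \<H> X) Z)"
proof -
  let ?L = "log 2 (\<alpha> * M / \<epsilon>)" and ?S = "{replicate T (1 :: nat)}"
  note L = log_ratio_ge[OF M \<epsilon> \<alpha>]
  have R1: "1 \<le> (\<epsilon> * Q)\<^sup>2" using Q by simp
  have size: "\<epsilon> * Q\<^sup>2 * (real M)\<^sup>2 = (\<epsilon> * Q * M)\<^sup>2 / \<epsilon>"
    using \<epsilon> by (simp add: power2_eq_square)
  have "0 \<le> \<epsilon> * Q * M" using Q by simp
  then have "(\<epsilon> * Q * M)\<^sup>2 \<le> (2 ^ 14)\<^sup>2" using Q by (intro power_mono) auto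
  then have size_le: "\<epsilon> * Q\<^sup>2 * (real M)\<^sup>2 / 2 ^ 44 \<le> 1 / (2 ^ 16 * \<epsilon>)"
    using \<epsilon> unfolding size
    by (simp add: divide_divide_eq_left divide_le_eq)
  have "1 * 1 \<le> (\<epsilon> * Q)\<^sup>2 * (real M)\<^sup>2" using M R1 by (intro mult_mono) auto
  then have "6 / \<epsilon> \<le> 6 * \<epsilon> * Q\<^sup>2 * (real M)\<^sup>2"
    using \<epsilon> by (simp add: field_simps power2_eq_square)
  then have N': "6 / \<epsilon> \<le> N" using N by simp
  have S: "?S \<subseteq> tuples M T" using M by (auto simp: tuples_def)
  have cardS: "\<alpha> * card ?S \<le> \<epsilon>\<^sup>2 * real M ^ T"
  proof -
    \<comment> \<open>\<open>T\<close> is at least twice the logarithm of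
      \<open>\<alpha> * M / \<epsilon>\<close>, so \<open>2 ^ T\<close> already reaches the square
      of that ratio and one tuple is light enough.\<close>
    have "1 * 2 \<le> (\<epsilon> * Q)\<^sup>2 * real M" using M R1 by (intro mult_mono) auto
    then have "2 * ?L \<le> (\<epsilon> * Q)\<^sup>2 * real M * ?L" using L by (intro mult_right_mono) auto
    then have "2 * ?L \<le> T" using T by (simp add: power_mult_distrib)
    then have "2 powr (2 * ?L) \<le> 2 powr T" by simp
    also have "\<dots> \<le> real M ^ T" using M by (simp add: powr_realpow power_mono)
    also have "2 powr (2 * ?L) = (2 powr ?L)\<^sup>2"
      by (metis powr_numeral powr_powr mult.commute powr_ge_zero)
    also have "2 powr ?L = \<alpha> * M / \<epsilon>" using L by simp
    finally have "\<epsilon>\<^sup>2 * (\<alpha> * M / \<epsilon>)\<^sup>2 \<le> \<epsilon>\<^sup>2 * real M ^ T" by (intro mult_left_mono) auto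
    moreover have "\<alpha> \<le> \<epsilon>\<^sup>2 * (\<alpha> * M / \<epsilon>)\<^sup>2"
      using alpha_div_square_le[of M \<epsilon> \<alpha>] M \<epsilon> \<alpha> L by (simp add: divide_le_eq)
    ultimately show ?thesis by simp
  qed
  show ?thesis
  proof (cases "\<epsilon> * M \<le> 1 / 4")
    case True
    \<comment> \<open>With \<open>k = e\<close>, where the template is constant, \<open>y\<close> is
      the largest \<open>e\<close> that the bias condition allows. The case hypothesis makes it at
      least 1, so rounding down loses at most a factor 2.\<close>
    define y where "y = 1 / (4 * \<epsilon> * M)"
    define e where "e = nat \<lfloor>y\<rfloor>"
    have y: "y \<ge> 1" using True M \<epsilon> by (simp add: y_def field_simps)
    then have "\<lfloor>y\<rfloor> \<ge> 1" by simp
    then have e: "e \<ge> 1" "real e \<le> y" "y / 2 \<le> real e"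
      unfolding e_def by linarith+
    have bias: "4 * \<epsilon> * M * e \<le> 1" using e(2) M \<epsilon> by (simp add: y_def field_simps)
    have "real (M * e) \<le> 1 / (4 * \<epsilon>)" using bias \<epsilon> by (simp add: field_simps)
    also have "\<dots> \<le> 6 / \<epsilon>" using \<epsilon> by (simp add: field_simps)
    finally have "real (M * e) \<le> real N" using N' by simp
    then have MeN: "M * e \<le> N" by (simp only: of_nat_le_iff)
    have collapse: "map (biased_template M e) xs = replicate T 1" if "xs \<in> tuples (M * e) T" for xs
      using that by (auto simp: tuples_def biased_template_def map_replicate_const[symmetric] subset_iff intro!: map_cong)
    have far: "\<exists>\<H> X. two_universal N M \<H> \<and> block_source (M * e) N T X \<and>
      (\<forall>Z. set_pmf Z \<subseteq> tuples M T \<longrightarrow> collision_prob Z \<le> \<alpha> / real M ^ T \<longrightarrow> eps_far \<epsilon> (hashed \<H> X) Z)"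
    proof (rule exists_far_of_biased_template[OF _ _ MeN order_refl \<epsilon> _ _ S cardS])
      show "4 * \<epsilon> * M * (real e)\<^sup>2 \<le> e"
        using mult_right_mono[OF bias, of "real e"] by (simp add: power2_eq_square mult_ac)
      have "{xs \<in> tuples (M * e) T. map (biased_template M e) xs \<in> ?S} = tuples (M * e) T"
        using collapse by auto
      then show "2 / 3 * real (M * e) ^ T
        \<le> real (card {xs \<in> tuples (M * e) T. map (biased_template M e) xs \<in> ?S})"
        by (simp add: card_tuples)
    qed (use M e \<alpha> in auto)
    have "1 / (8 * \<epsilon>) \<le> real (M * e)"
      using mult_left_mono[OF e(3), of "real M"] M \<epsilon> by (simp add: y_def)
    moreover have "1 / (2 ^ 16 * \<epsilon>) \<le> 1 / (8 * \<epsilon>)" using \<epsilon> by (simp add: field_simps)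
    ultimately have "real (M * e) \<ge> \<epsilon> * Q\<^sup>2 * (real M)\<^sup>2 / 2 ^ 44" using size_le by linarith
    with far show ?thesis by blast
  next
    case False
    \<comment> \<open>A one-point source is enough: \<open>\<epsilon> * Q \<ge> 1\<close> forces
      \<open>M \<le> 2 ^ 14\<close>, hence \<open>\<epsilon> \<ge> 1 / 2 ^ 16\<close>, and the
      required \<open>K\<close> is at most 1.\<close>
    have empty: "colliding_pairs {1..1 :: nat} (\<lambda>_. 1 :: nat) = {}" by (auto simp: colliding_pairs_def)
    have tup: "tuples 1 T = {replicate T 1}"
      by (auto simp: tuples_def subset_iff replicate_eqI)
    have far: "\<exists>\<H> X. two_universal N M \<H> \<and> block_source 1 N T X \<and>
      (\<forall>Z. set_pmf Z \<subseteq> tuples M T \<longrightarrow> collision_prob Z \<le> \<alpha> / real M ^ T \<longrightarrow> eps_far \<epsilon> (hashed \<H> X) Z)"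
    proof (rule exists_far_of_templates[where ?f0.0 = "\<lambda>_. 1" and ?f1.0 = "\<lambda>_. 1", OF _ _ _ \<epsilon> _ _ _ refl refl _ _ S cardS])
      have "1 \<le> 6 / \<epsilon>" using \<epsilon> by simp
      then have "1 \<le> real N" using N' by linarith
      then show "1 \<le> N" by simp
      have "{xs \<in> tuples 1 T. map (\<lambda>_. 1) xs \<in> ?S} = {replicate T 1}" unfolding tup by auto
      then show "2 / 3 * real 1 ^ T \<le> real (card {xs \<in> tuples 1 T. map (\<lambda>_. 1) xs \<in> ?S})"
        by simp
    qed (use M \<alpha> empty in simp_all)
    have "M * 1 \<le> \<epsilon> * Q * M" using Q M by (simp add: mult.commute)
    then have "real M \<le> 2 ^ 14" using Q by simp
    then have "1 / 4 \<le> \<epsilon> * 2 ^ 14" using False \<epsilon> by (smt (verit) mult_left_mono)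
    then have "1 / (2 ^ 16 * \<epsilon>) \<le> 1" using \<epsilon> by (simp add: field_simps)
    then have "real 1 \<ge> \<epsilon> * Q\<^sup>2 * (real M)\<^sup>2 / 2 ^ 44" using size_le by linarith
    with far show ?thesis by blast
  qed
qed

lemma sqrt_diff_ge_scaled:
  fixes b s m :: real
  assumes "b \<ge> 0" "s \<ge> 0" "m > 0"
  shows "(b - s)\<^sup>2 / (2 * (2 + b + s)) / m \<le> (sqrt ((1 + b) / m) - sqrt ((1 + s) / m))\<^sup>2"
proof -
  have "(b - s)\<^sup>2 / (2 * (2 + b + s)) / m = ((1 + b) / m - (1 + s) / m)\<^sup>2 / (2 * ((1 + b) / m + (1 + s) / m))"
    using assms by (simp add: diff_divide_distrib[symmetric] add_divide_distrib[symmetric] power_divide power2_eq_square)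
  also have "\<dots> \<le> (sqrt ((1 + b) / m) - sqrt ((1 + s) / m))\<^sup>2"
    using assms by (intro sqrt_diff_ge) auto
  finally show ?thesis .
qed

text \<open>The biased template takes the value 1 with frequency \<open>(1 + 2 * b) / M\<close>, and
  the threshold \<open>\<theta>\<close> lies halfway between this and \<open>1 / M\<close>. With
  \<open>R = \<epsilon> * Q\<close>, the parameters make \<open>b\<close> of order
  \<open>1 / R\<close>, so that tail exponents of order \<open>T * b\<^sup>2 / M\<close> reach the
  order of \<open>L\<close>.\<close>

lemma exists_far_large:
  fixes \<epsilon> \<alpha> Q :: real
  assumes M: "M \<ge> 2" and \<epsilon>: "0 < \<epsilon>" "\<epsilon> < 1 / 4" and \<alpha>: "\<alpha> \<ge> 1"
    and Q: "real M \<le> Q" "\<epsilon> * Q \<ge> 1" "\<epsilon> * Q * M \<ge> 2 ^ 14"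
    and N: "real N \<ge> 6 * \<epsilon> * Q\<^sup>2 * (real M)\<^sup>2"
    and T: "real T \<ge> \<epsilon>\<^sup>2 * Q\<^sup>2 * M * log 2 (\<alpha> * M / \<epsilon>)"
  shows "\<exists>K \<H> X. real K \<ge> \<epsilon> * Q\<^sup>2 * (real M)\<^sup>2 / 2 ^ 44 \<and> two_universal N M \<H> \<and> block_source K N T X \<and>
    (\<forall>Z. set_pmf Z \<subseteq> tuples M T \<longrightarrow> collision_prob Z \<le> \<alpha> / real M ^ T \<longrightarrow> eps_far \<epsilon> (hashed \<H> X) Z)"
proof -
  define L where "L = log 2 (\<alpha> * M / \<epsilon>)"
  note y8 = log_ratio_ge(1)[OF M \<epsilon> \<alpha>] and L3 = log_ratio_ge(2)[OF M \<epsilon> \<alpha>, folded L_def]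
  define R where "R = \<epsilon> * Q"
  have R: "R \<ge> 1" "R * M \<ge> 2 ^ 14" using Q by (simp_all add: R_def)
  \<comment> \<open>Otherwise \<open>M \<le> Q < 256\<close> and \<open>\<epsilon> < 1 / 4\<close>
    would give a product below \<open>64 * 256 = 2 ^ 14\<close>.\<close>
  have Q256: "Q \<ge> 256"
  proof (rule ccontr)
    assume "\<not> Q \<ge> 256"
    then have "Q < 256" "real M < 256" using Q by auto
    moreover from \<open>Q < 256\<close> have "\<epsilon> * Q \<le> 1 / 4 * 256" using \<epsilon> Q by (intro mult_mono) auto
    ultimately have "\<epsilon> * Q * M < 64 * 256" using \<epsilon> Q M by (intro mult_le_less_imp_less) auto
    then show False using Q by simp
  qed
  \<comment> \<open>\<open>e\<close> and \<open>k\<close> (from \<open>z\<close>) are matched so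
    that the bias condition reduces to \<open>z / 2 \<le> k\<close>, while \<open>M * k\<close>
    keeps the order of \<open>\<epsilon> * Q\<^sup>2 * M\<^sup>2\<close>.\<close>
  define e where "e = nat \<lfloor>Q / 256\<rfloor>"
  have "\<lfloor>Q / 256\<rfloor> \<ge> 1" using Q256 by simp
  then have e: "e \<ge> 1" "real e \<le> Q / 256" "Q / 512 \<le> real e"
    unfolding e_def by linarith+
  define z where "z = R * M * e / 32"
  define k where "k = nat \<lfloor>z\<rfloor>"
  have "2 ^ 14 * real e \<le> R * M * e" using R by (intro mult_right_mono) auto
  then have ez: "real e \<le> z" using e by (simp add: z_def)
  then have ek: "e \<le> k" unfolding k_def by (simp add: le_nat_floor)
  have "z \<ge> 1" using ez e by simp
  then have "\<lfloor>z\<rfloor> \<ge> 1" by simp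
  then have k: "k \<ge> 1" "real k \<le> z" "z / 2 \<le> real k"
    unfolding k_def by linarith+
  have bias: "4 * \<epsilon> * M * (real e)\<^sup>2 \<le> k"
  proof -
    have "4 * \<epsilon> * M * e * e \<le> 4 * \<epsilon> * M * e * (Q / 256)"
      using e \<epsilon> by (intro mult_left_mono) auto
    also have "\<dots> = z / 2" by (simp add: z_def R_def)
    finally show ?thesis using k by (simp add: power2_eq_square mult_ac)
  qed
  have "real (M * k) \<le> M * z" using k by (simp add: mult_left_mono)
  also have "\<dots> \<le> M * (R * M * (Q / 256) / 32)"
    unfolding z_def using e R by (intro mult_left_mono divide_right_mono) auto
  also have "\<dots> = \<epsilon> * Q\<^sup>2 * (real M)\<^sup>2 / 8192" by (simp add: R_def power2_eq_square)
  also have "\<dots> \<le> 6 * \<epsilon> * Q\<^sup>2 * (real M)\<^sup>2" using \<epsilon> by simp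
  finally have "real (M * k) \<le> real N" using N by simp
  then have MkN: "M * k \<le> N" by (simp only: of_nat_le_iff)
  have "\<epsilon> * Q\<^sup>2 * (real M)\<^sup>2 / 2 ^ 15 = M * (R * M * (Q / 512) / 32 / 2)"
    by (simp add: R_def power2_eq_square)
  also have "\<dots> \<le> M * (z / 2)"
    unfolding z_def using e R by (intro mult_left_mono divide_right_mono) auto
  also have "\<dots> \<le> real (M * k)" using mult_left_mono[OF k(3), of "real M"] by simp
  finally have large: "real (M * k) \<ge> \<epsilon> * Q\<^sup>2 * (real M)\<^sup>2 / 2 ^ 15" .
  have K: "real (M * k) \<ge> \<epsilon> * Q\<^sup>2 * (real M)\<^sup>2 / 2 ^ 44"
    by (rule order_trans[OF _ large]) (use \<epsilon> in \<open>auto intro!: divide_left_mono\<close>)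

  \<comment> \<open>Half the relative excess of the value 1: its fibre has
    \<open>k + (M - 1) * e\<close> points instead of \<open>k\<close>.\<close>
  define b where "b = (real M - 1) * e / (2 * k)"
  have "real M / 2 * e \<le> (real M - 1) * e" using M by (intro mult_right_mono) auto
  then have "real M / 2 * e / (2 * k) \<le> b" unfolding b_def by (intro divide_right_mono) auto
  then have "R * (real M / 2 * e / (2 * k)) \<le> R * b" using R by (intro mult_left_mono) auto
  moreover have "R * (real M / 2 * e / (2 * k)) = 8 * (z / k)"
    unfolding z_def by simp
  moreover have "z / k \<ge> 1" using k by simp
  ultimately have Rb: "R * b \<ge> 8" by linarith
  have b0: "b \<ge> 0" using M by (simp add: b_def)
  have "1 * b \<le> R * b" using R b0 by (intro mult_right_mono) auto
  then have "8 * b + 64 \<le> 8 * (R * b) + 8 * (R * b)" using Rb by linarith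
  also have "\<dots> \<le> 2 * ((R * b) * (R * b))"
    using mult_right_mono[OF Rb, of "R * b"] Rb by linarith
  finally have "8 + 4 * b \<le> (R * b) * (R * b)" using b0 by linarith
  \<comment> \<open>The form \<open>8 + 4 * b\<close> suits the denominators
    \<open>2 * (2 + b + s)\<close> below: the quotient is 2 at \<open>s = 0\<close> and at least
    \<open>2 / 3\<close> at \<open>s = 2 * b\<close>.\<close>
  then have Rb2: "R\<^sup>2 * b\<^sup>2 \<ge> 8 + 4 * b" by (simp only: power2_eq_square mult_ac)
  have TM: "real T / M \<ge> R\<^sup>2 * L"
    using T M by (simp add: L_def R_def field_simps power2_eq_square)
  \<comment> \<open>The condition on \<open>s\<close> admits the uniform frequency,
    \<open>s = 0\<close>, and the biased one, \<open>s = 2 * b\<close>; the threshold is equally far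
    from both.\<close>
  have tail: "real T * (sqrt ((1 + b) / M) - sqrt ((1 + s) / M))\<^sup>2 \<ge> L * ((8 + 4 * b) / (2 * (2 + b + s)))"
    if "s \<ge> 0" "(b - s)\<^sup>2 = b\<^sup>2" for s
  proof -
    have "L * ((8 + 4 * b) / (2 * (2 + b + s))) \<le> L * (R\<^sup>2 * b\<^sup>2 / (2 * (2 + b + s)))"
      using that b0 L3 Rb2 by (intro mult_left_mono divide_right_mono) auto
    also have "\<dots> = R\<^sup>2 * L * (b\<^sup>2 / (2 * (2 + b + s)))" by simp
    also have "\<dots> \<le> real T / M * (b\<^sup>2 / (2 * (2 + b + s)))"
      using that b0 by (intro mult_right_mono TM) auto
    also have "\<dots> = real T * ((b - s)\<^sup>2 / (2 * (2 + b + s)) / M)" by (simp add: that)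
    also have "\<dots> \<le> real T * (sqrt ((1 + b) / M) - sqrt ((1 + s) / M))\<^sup>2"
      using that b0 M by (intro mult_left_mono sqrt_diff_ge_scaled) auto
    finally show ?thesis .
  qed

  define \<theta> where "\<theta> = (1 + b) / M"
  define S where "S = {xs \<in> tuples M T. real (length (filter (\<lambda>x. x \<in> {1}) xs)) \<ge> \<theta> * T}"
  have "real T * (sqrt \<theta> - sqrt (1 / M))\<^sup>2 \<ge> 2 * L"
  proof -
    have "2 * L = L * ((8 + 4 * b) / (2 * (2 + b + 0)))" using b0 by (simp add: field_simps)
    also have "\<dots> \<le> real T * (sqrt ((1 + b) / M) - sqrt ((1 + 0) / M))\<^sup>2" by (rule tail) simp_all
    finally show ?thesis by (simp add: \<theta>_def)
  qed
  then have "exp (- real T * (sqrt \<theta> - sqrt (1 / M))\<^sup>2) \<le> exp (- (2 * L))" by simp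
  also have "\<dots> \<le> 1 / (\<alpha> * M / \<epsilon>)\<^sup>2" unfolding L_def using y8 by (intro exp_minus_log_le) simp
  finally have "real M ^ T * exp (- real T * (sqrt \<theta> - sqrt (1 / M))\<^sup>2) \<le> real M ^ T * (1 / (\<alpha> * M / \<epsilon>)\<^sup>2)"
    by (rule mult_left_mono) simp
  moreover have "real (card S) \<le> real M ^ T * exp (- real T * (sqrt \<theta> - sqrt (1 / M))\<^sup>2)"
    unfolding S_def using M b0 by (intro count_upper_tail) (auto simp: \<theta>_def divide_right_mono)
  ultimately have "real (card S) \<le> real M ^ T * (1 / (\<alpha> * M / \<epsilon>)\<^sup>2)" by (rule order_trans[rotated])
  then have "\<alpha> * card S \<le> \<alpha> * (real M ^ T * (1 / (\<alpha> * M / \<epsilon>)\<^sup>2))" using \<alpha> by (intro mult_left_mono) auto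
  also have "\<dots> = \<alpha> / (\<alpha> * M / \<epsilon>)\<^sup>2 * real M ^ T" by simp
  also have "\<dots> \<le> \<epsilon>\<^sup>2 * real M ^ T"
    using M \<epsilon> \<alpha> by (intro mult_right_mono alpha_div_square_le) auto
  finally have cardS: "\<alpha> * card S \<le> \<epsilon>\<^sup>2 * real M ^ T" .

  \<comment> \<open>Counting ones after the template is counting hits of \<open>A\<close> in a
    uniform tuple over \<open>[M * k]\<close>, so the lower tail bound applies.\<close>
  define A where "A = {x \<in> {1..M * k}. biased_template M e x = 1}"
  have "card A = M * e + (k - e)"
    unfolding A_def using M ek by (subst card_biased_template) auto
  then have "real (card A) = real k + (real M - 1) * e"
    using ek by (simp add: of_nat_diff algebra_simps)
  moreover have "1 + 2 * b = (real k + (real M - 1) * e) / k"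
    using k(1) by (simp add: b_def add_divide_distrib)
  ultimately have p: "(1 + 2 * b) / M = card A / real (M * k)"
    by (simp add: mult.commute)
  have range: "map (biased_template M e) xs \<in> tuples M T" if "xs \<in> tuples (M * k) T" for xs
    using that M by (intro map_in_tuples biased_template_range) auto
  have count: "length (filter (\<lambda>x. x \<in> {1}) (map (biased_template M e) xs)) = length (filter (\<lambda>x. x \<in> A) xs)"
    if "xs \<in> tuples (M * k) T" for xs
  proof -
    have "filter (\<lambda>x. biased_template M e x = 1) xs = filter (\<lambda>x. x \<in> A) xs"
      using that by (intro filter_cong) (auto simp: A_def tuples_def)
    then show ?thesis by (simp add: filter_map o_def)
  qed
  let ?light = "{xs \<in> tuples (M * k) T. real (length (filter (\<lambda>x. x \<in> A) xs)) \<le> \<theta> * T}"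
  let ?hit = "{xs \<in> tuples (M * k) T. map (biased_template M e) xs \<in> S}"
  let ?E = "exp (- real T * (sqrt \<theta> - sqrt ((1 + 2 * b) / M))\<^sup>2)"
  \<comment> \<open>\<open>L \<ge> 3\<close> raises the quotient \<open>2 / 3\<close> to an exponent
    of 2, and \<open>exp (- 2) \<le> 1 / 3\<close> leaves the share \<open>2 / 3\<close> needed for
    \<open>hit\<close>.\<close>
  have "2 \<le> 3 * ((8 + 4 * b) / (2 * (2 + b + 2 * b)))" using b0 by (simp add: field_simps)
  also have "\<dots> \<le> L * ((8 + 4 * b) / (2 * (2 + b + 2 * b)))"
    using L3 b0 by (intro mult_right_mono) auto
  also have "\<dots> \<le> real T * (sqrt \<theta> - sqrt ((1 + 2 * b) / M))\<^sup>2"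
    unfolding \<theta>_def using b0 by (intro tail) auto
  finally have "?E \<le> exp (- 2)" by simp
  also have "exp (- 2) \<le> (1 / 3 :: real)"
    using exp_ge_add_one_self[of 2] by (simp add: exp_minus field_simps)
  finally have "real (M * k) ^ T * ?E \<le> real (M * k) ^ T * (1 / 3)"
    by (rule mult_left_mono) simp
  moreover have "real (card ?light) \<le> real (M * k) ^ T * ?E"
    using M k b0 by (intro count_lower_tail p) (auto simp: \<theta>_def A_def divide_right_mono)
  ultimately have light: "real (card ?light) \<le> real (M * k) ^ T * (1 / 3)" by (rule order_trans[rotated])
  have "tuples (M * k) T \<subseteq> ?hit \<union> ?light"
    using range count by (auto simp: S_def)
  then have "card (tuples (M * k) T) \<le> card (?hit \<union> ?light)" by (intro card_mono) auto
  also have "\<dots> \<le> card ?hit + card ?light" by (rule card_Un_le)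
  finally have "real (M * k) ^ T \<le> real (card ?hit) + real (card ?light)"
    unfolding card_tuples of_nat_power[symmetric] of_nat_add[symmetric] by (rule of_nat_mono)
  then have hit: "real (card ?hit) \<ge> 2 / 3 * real (M * k) ^ T" using light by linarith
  have "\<exists>\<H> X. two_universal N M \<H> \<and> block_source (M * k) N T X \<and>
    (\<forall>Z. set_pmf Z \<subseteq> tuples M T \<longrightarrow> collision_prob Z \<le> \<alpha> / real M ^ T \<longrightarrow> eps_far \<epsilon> (hashed \<H> X) Z)"
    by (rule exists_far_of_biased_template[OF _ _ MkN ek \<epsilon> _ bias _ cardS hit])
      (use M k \<alpha> in \<open>auto simp: S_def\<close>)
  with K show ?thesis by blast
qed

theorem theorem4p12:
  "\<exists>c::real. c > 0 \<and>
     (\<forall>(M::nat) (\<epsilon>::real) (\<alpha>::real) (t::int) (N::nat) (T::nat).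
        primepow M \<longrightarrow> 0 < \<epsilon> \<longrightarrow> \<epsilon> < 1 / 4 \<longrightarrow> 1 \<le> \<alpha> \<longrightarrow>
        \<epsilon> * real M powi (t - 1) \<ge> 1 \<longrightarrow>
        real N \<ge> 6 * \<epsilon> * real M powi (2 * t) \<longrightarrow>
        int T = \<lceil>\<epsilon>\<^sup>2 * real M powi (2 * t - 1) * log 2 (\<alpha> * real M / \<epsilon>)\<rceil> \<longrightarrow>
        (\<exists>(K::nat) (\<H>::(nat \<Rightarrow> nat) multiset) (X::nat list pmf).
           real K \<ge> c * real M * real T / (\<epsilon> * log 2 (\<alpha> * real M / \<epsilon>)) \<and>
           two_universal N M \<H> \<and>
           block_source K N T X \<and>
           (\<forall>Z::nat list pmf.
              set_pmf Z \<subseteq> tuples M T \<longrightarrow>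
              collision_prob Z \<le> \<alpha> / real M ^ T \<longrightarrow>
              eps_far \<epsilon> (hashed \<H> X) Z)))"
proof (intro exI[of _ "1 / 2 ^ 45"] conjI allI impI)
  fix M :: nat and \<epsilon> \<alpha> :: real and t :: int and N T :: nat
  assume pp: "primepow M" and \<epsilon>: "0 < \<epsilon>" "\<epsilon> < 1 / 4" and \<alpha>: "1 \<le> \<alpha>"
    and Q: "\<epsilon> * real M powi (t - 1) \<ge> 1"
    and N: "real N \<ge> 6 * \<epsilon> * real M powi (2 * t)"
    and T: "int T = \<lceil>\<epsilon>\<^sup>2 * real M powi (2 * t - 1) * log 2 (\<alpha> * real M / \<epsilon>)\<rceil>"
  have M: "M \<ge> 2" using primepow_gt_Suc_0[OF pp] by simp
  define Q where "Q = real M powi (t - 1)"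
  define L where "L = log 2 (\<alpha> * real M / \<epsilon>)"
  have L: "L \<ge> 3" unfolding L_def by (rule log_ratio_ge[OF M \<epsilon> \<alpha>])
  have Q1: "\<epsilon> * Q \<ge> 1" using Q by (simp add: Q_def)
  have "Q > 0" using M by (simp add: Q_def)
  then have "\<epsilon> * Q < 1 / 4 * Q" using \<epsilon> by (intro mult_strict_right_mono) auto
  then have "Q > 1" using Q1 by simp
  \<comment> \<open>\<open>t\<close> is an integer, and \<open>Q > 1\<close> forces a positive
    exponent \<open>t - 1\<close>; this gives \<open>M \<le> Q\<close>, which the large regime
    relies on.\<close>
  have "t \<ge> 2"
  proof (rule ccontr)
    assume "\<not> t \<ge> 2"
    then have "Q \<le> real M powi 0" unfolding Q_def using M by (intro power_int_increasing) auto
    then show False using \<open>Q > 1\<close> by simp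
  qed
  then have "real M powi 1 \<le> Q" unfolding Q_def using M by (intro power_int_increasing) auto
  then have MQ: "real M \<le> Q" by simp
  have Q2: "Q\<^sup>2 = real M powi (2 * t - 2)"
    using M by (simp add: Q_def power2_eq_square flip: power_int_add)
  have p2: "real M powi (2 * t) = Q\<^sup>2 * (real M)\<^sup>2"
  proof -
    have "real M powi (2 * t) = real M powi (2 * t - 2 + 2)" by simp
    also have "\<dots> = Q\<^sup>2 * (real M)\<^sup>2" unfolding Q2 using M by (subst power_int_add) auto
    finally show ?thesis .
  qed
  have p1: "real M powi (2 * t - 1) = Q\<^sup>2 * real M"
  proof -
    have "real M powi (2 * t - 1) = real M powi (2 * t - 2 + 1)" by simp
    also have "\<dots> = Q\<^sup>2 * real M" unfolding Q2 using M by (subst power_int_add) auto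
    finally show ?thesis .
  qed
  let ?V = "\<epsilon>\<^sup>2 * Q\<^sup>2 * M * L"
  have "int T = \<lceil>?V\<rceil>" using T unfolding p1 L_def[symmetric] by (simp only: mult_ac)
  then have T': "?V \<le> real T" "real T \<le> ?V + 1" by linarith+
  \<comment> \<open>Once \<open>?V \<ge> 1\<close>, rounding up to \<open>T\<close> costs at most a
    factor 2, the gap between \<open>2 ^ 44\<close> in the two regimes and \<open>2 ^ 45\<close> in
    the constant.\<close>
  have "1 \<le> (\<epsilon> * Q)\<^sup>2" using Q1 by simp
  then have "1 * 1 * 1 \<le> (\<epsilon> * Q)\<^sup>2 * M * L" using M L by (intro mult_mono) auto
  then have "1 \<le> ?V" by (simp add: power_mult_distrib)
  then have T2: "real T \<le> 2 * ?V" using T' by simp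
  have N': "real N \<ge> 6 * \<epsilon> * Q\<^sup>2 * (real M)\<^sup>2" using N unfolding p2 by (simp only: mult_ac)
  have "1 / 2 ^ 45 * real M * real T / (\<epsilon> * L) \<le> 1 / 2 ^ 45 * real M * (2 * ?V) / (\<epsilon> * L)"
    using T2 \<epsilon> L by (intro divide_right_mono mult_left_mono) auto
  also have "\<dots> = \<epsilon> * Q\<^sup>2 * (real M)\<^sup>2 / 2 ^ 44"
    using \<epsilon> L by (simp add: field_simps power2_eq_square)
  finally have bound: "1 / 2 ^ 45 * real M * real T / (\<epsilon> * L) \<le> \<epsilon> * Q\<^sup>2 * (real M)\<^sup>2 / 2 ^ 44" .
  have "\<exists>K \<H> X. real K \<ge> \<epsilon> * Q\<^sup>2 * (real M)\<^sup>2 / 2 ^ 44 \<and> two_universal N M \<H> \<and> block_source K N T X \<and>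
    (\<forall>Z. set_pmf Z \<subseteq> tuples M T \<longrightarrow> collision_prob Z \<le> \<alpha> / real M ^ T \<longrightarrow> eps_far \<epsilon> (hashed \<H> X) Z)"
  proof (cases "\<epsilon> * Q * M < 2 ^ 14")
    case True
    then show ?thesis using exists_far_bounded[OF M \<epsilon> \<alpha> Q1 _ N'] T'(1)[unfolded L_def] by blast
  next
    case False
    then have "\<epsilon> * Q * M \<ge> 2 ^ 14" by simp
    then show ?thesis using exists_far_large[OF M \<epsilon> \<alpha> MQ Q1 _ N'] T'(1)[unfolded L_def] by blast
  qed
  then obtain K \<H> X where KHX: "real K \<ge> \<epsilon> * Q\<^sup>2 * (real M)\<^sup>2 / 2 ^ 44"
    "two_universal N M \<H>" "block_source K N T X"
    "\<forall>Z. set_pmf Z \<subseteq> tuples M T \<longrightarrow> collision_prob Z \<le> \<alpha> / real M ^ T \<longrightarrow> eps_far \<epsilon> (hashed \<H> X) Z"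
    by blast
  show "\<exists>K \<H> X. real K \<ge> 1 / 2 ^ 45 * real M * real T / (\<epsilon> * log 2 (\<alpha> * real M / \<epsilon>)) \<and>
    two_universal N M \<H> \<and> block_source K N T X \<and>
    (\<forall>Z. set_pmf Z \<subseteq> tuples M T \<longrightarrow> collision_prob Z \<le> \<alpha> / real M ^ T \<longrightarrow> eps_far \<epsilon> (hashed \<H> X) Z)"
    using order_trans[OF bound KHX(1)] KHX(2-4) unfolding L_def by blast
qed simp

end
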